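(* Let $t \ge 2$ be an integer. If there is a polynomial-time $\alpha$-approximation algorithm for Robust $(t-1)$-NU$k$C, then there is a polynomial-time $(2\alpha+2)$-approximation algorithm for $t$-NU$k$C.
   Context: $t$-Non-Uniform $k$-Center ($t$-NU$k$C): the input is a finite metric space $(X,d)$, radii $r_1 \ge r_2 \ge \dots \ge r_t \ge 0$ and nonnegative integers $k_1,\dots,k_t$. A solution consists of sets $C_i \subseteq X$ with $|C_i| \le k_i$ ($i=1,\dots,t$) and a dilation factor $\alpha \ge 0$ such that the balls $\mathcal{B}(c,\alpha r_i)=\{u\in X: d(u,c)\le \alpha r_i\}$, $c \in C_i$, $i=1,\dots,t$, together cover all of $X$; the objective is to minimize $\alpha$. Robust $t$-NU$k$C is the same problem with an additional integer parameter $m$, where the balls only need to cover at least $m$ points of $X$. An $\alpha$-approximation algorithm outputs a solution whose dilation factor is at most $\alpha$ times the optimal dilation factor. *)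

theory Defs
  imports
    "HOL-Analysis.Abstract_Metric_Spaces"
    "HOL-Library.Log_Nat"
    "HOL-Computational_Algebra.Polynomial"
begin

section \<open>Non-uniform k-center and its robust version\<close>

text \<open>
  The radii \<open>r\<close>, the budgets \<open>k\<close> and the center sets \<open>C\<close> are lists of the same length \<open>t\<close>,
  indexed from 0.
\<close>

definition admissible_centers :: "'a set \<Rightarrow> nat list \<Rightarrow> 'a set list \<Rightarrow> bool" where
  "admissible_centers X k C \<longleftrightarrow>
     length C = length k \<and> (\<forall>i<length k. C ! i \<subseteq> X \<and> card (C ! i) \<le> k ! i)"

definition covered ::
    "'a set \<Rightarrow> ('a \<Rightarrow> 'a \<Rightarrow> real) \<Rightarrow> real list \<Rightarrow> 'a set list \<Rightarrow> real \<Rightarrow> 'a set" where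
  "covered X d r C \<beta> = (\<Union>i<length r. \<Union>c\<in>C ! i. Metric_space.mcball X d c (\<beta> * r ! i))"

definition nukc_solution ::
    "'a set \<Rightarrow> ('a \<Rightarrow> 'a \<Rightarrow> real) \<Rightarrow> real list \<Rightarrow> nat list \<Rightarrow> 'a set list \<Rightarrow> real \<Rightarrow> bool" where
  "nukc_solution X d r k C \<beta> \<longleftrightarrow>
     admissible_centers X k C \<and> 0 \<le> \<beta> \<and> X \<subseteq> covered X d r C \<beta>"

definition robust_solution ::
    "'a set \<Rightarrow> ('a \<Rightarrow> 'a \<Rightarrow> real) \<Rightarrow> real list \<Rightarrow> nat list \<Rightarrow> int \<Rightarrow> 'a set list \<Rightarrow> real \<Rightarrow> bool" where
  "robust_solution X d r k m C \<beta> \<longleftrightarrow>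
     admissible_centers X k C \<and> 0 \<le> \<beta> \<and> m \<le> int (card (covered X d r C \<beta>))"

text \<open>
  The optimal dilation factors. They are meaningful only if some solution exists: for instance, an
  instance on a nonempty space with all budgets 0 has no solution.
\<close>

definition nukc_opt ::
    "'a set \<Rightarrow> ('a \<Rightarrow> 'a \<Rightarrow> real) \<Rightarrow> real list \<Rightarrow> nat list \<Rightarrow> real" where
  "nukc_opt X d r k = Inf {\<beta>. \<exists>C. nukc_solution X d r k C \<beta>}"

definition robust_opt ::
    "'a set \<Rightarrow> ('a \<Rightarrow> 'a \<Rightarrow> real) \<Rightarrow> real list \<Rightarrow> nat list \<Rightarrow> int \<Rightarrow> real" where
  "robust_opt X d r k m = Inf {\<beta>. \<exists>C. robust_solution X d r k m C \<beta>}"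


section \<open>Polynomial-time algorithms\<close>

text \<open>
  The machine model is a WHILE language whose variables hold binary trees with integer leaves.
  Time is charged logarithmically: evaluating an expression costs the total size (with integers
  in binary) of the values of all its subexpressions. Every primitive (pairing, projection,
  addition, subtraction, multiplication, comparison) is computable by a Turing machine in time
  polynomial in the sizes charged for it, and conversely a Turing machine is simulated with
  polynomial overhead, its tape being stored as nested pairs. Hence polynomial time in this
  model is polynomial time on Turing machines.
\<close>

datatype val = Num int | Pair val val

fun val_size :: "val \<Rightarrow> nat" where
  "val_size (Num i) = 1 + nat (bitlen \<bar>i\<bar>)"
| "val_size (Pair u v) = 1 + val_size u + val_size v"

text \<open>
  All primitives are total: an integer operation reads a pair as 0, and a projection of an
  integer is 0. The truth values are 0 and 1.
\<close>

fun int_of :: "val \<Rightarrow> int" where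
  "int_of (Num i) = i"
| "int_of (Pair u v) = 0"

fun left_of :: "val \<Rightarrow> val" where
  "left_of (Num i) = Num 0"
| "left_of (Pair u v) = u"

fun right_of :: "val \<Rightarrow> val" where
  "right_of (Num i) = Num 0"
| "right_of (Pair u v) = v"

fun is_pair :: "val \<Rightarrow> bool" where
  "is_pair (Num i) = False"
| "is_pair (Pair u v) = True"

definition val_of_bool :: "bool \<Rightarrow> val" where
  "val_of_bool b = Num (if b then 1 else 0)"

type_synonym store = "nat \<Rightarrow> val"

datatype expr =
    Var nat
  | Const int
  | MkPair expr expr
  | Left expr
  | Right expr
  | IsPair expr
  | Plus expr expr
  | Minus expr expr
  | Times expr expr
  | Less expr expr

fun eval_expr :: "expr \<Rightarrow> store \<Rightarrow> val" where
  "eval_expr (Var x) s = s x"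
| "eval_expr (Const i) s = Num i"
| "eval_expr (MkPair a b) s = Pair (eval_expr a s) (eval_expr b s)"
| "eval_expr (Left a) s = left_of (eval_expr a s)"
| "eval_expr (Right a) s = right_of (eval_expr a s)"
| "eval_expr (IsPair a) s = val_of_bool (is_pair (eval_expr a s))"
| "eval_expr (Plus a b) s = Num (int_of (eval_expr a s) + int_of (eval_expr b s))"
| "eval_expr (Minus a b) s = Num (int_of (eval_expr a s) - int_of (eval_expr b s))"
| "eval_expr (Times a b) s = Num (int_of (eval_expr a s) * int_of (eval_expr b s))"
| "eval_expr (Less a b) s = val_of_bool (int_of (eval_expr a s) < int_of (eval_expr b s))"

fun subexprs_cost :: "expr \<Rightarrow> store \<Rightarrow> nat" and expr_cost :: "expr \<Rightarrow> store \<Rightarrow> nat" where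
  "subexprs_cost (Var x) s = 0"
| "subexprs_cost (Const i) s = 0"
| "subexprs_cost (MkPair a b) s = expr_cost a s + expr_cost b s"
| "subexprs_cost (Left a) s = expr_cost a s"
| "subexprs_cost (Right a) s = expr_cost a s"
| "subexprs_cost (IsPair a) s = expr_cost a s"
| "subexprs_cost (Plus a b) s = expr_cost a s + expr_cost b s"
| "subexprs_cost (Minus a b) s = expr_cost a s + expr_cost b s"
| "subexprs_cost (Times a b) s = expr_cost a s + expr_cost b s"
| "subexprs_cost (Less a b) s = expr_cost a s + expr_cost b s"
| "expr_cost e s = val_size (eval_expr e s) + subexprs_cost e s"

datatype com =
    SKIP
  | Assign nat expr
  | Seq com com
  | IF expr com com
  | WHILE expr com

definition holds :: "expr \<Rightarrow> store \<Rightarrow> bool" where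
  "holds e s \<longleftrightarrow> int_of (eval_expr e s) \<noteq> 0"

text \<open>\<open>exec c s n s'\<close>: started in store \<open>s\<close>, the program \<open>c\<close> halts after time \<open>n\<close> in store \<open>s'\<close>.\<close>

inductive exec :: "com \<Rightarrow> store \<Rightarrow> nat \<Rightarrow> store \<Rightarrow> bool" where
  Skip: "exec SKIP s 1 s"
| Assign: "exec (Assign x e) s (1 + expr_cost e s) (s(x := eval_expr e s))"
| Seq: "exec c1 s n1 s1 \<Longrightarrow> exec c2 s1 n2 s2 \<Longrightarrow> exec (Seq c1 c2) s (1 + n1 + n2) s2"
| IfTrue: "holds e s \<Longrightarrow> exec c1 s n s' \<Longrightarrow> exec (IF e c1 c2) s (1 + expr_cost e s + n) s'"
| IfFalse: "\<not> holds e s \<Longrightarrow> exec c2 s n s' \<Longrightarrow> exec (IF e c1 c2) s (1 + expr_cost e s + n) s'"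
| WhileFalse: "\<not> holds e s \<Longrightarrow> exec (WHILE e c) s (1 + expr_cost e s) s"
| WhileTrue: "holds e s \<Longrightarrow> exec c s n1 s1 \<Longrightarrow> exec (WHILE e c) s1 n2 s2 \<Longrightarrow>
    exec (WHILE e c) s (1 + expr_cost e s + n1 + n2) s2"

lemma exec_deterministic:
  "exec c s n s' \<Longrightarrow> exec c s n' s'' \<Longrightarrow> n' = n \<and> s'' = s'"
proof (induction arbitrary: n' s'' rule: exec.induct)
  case (Seq c1 s n1 s1 c2 n2 s2)
  from Seq.prems show ?case by (cases rule: exec.cases) (use Seq.IH in blast)+
next
  case (IfTrue e s c1 n s' c2)
  from IfTrue.prems show ?case by (cases rule: exec.cases) (use IfTrue in blast)+
next
  case (IfFalse e s c2 n s' c1)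
  from IfFalse.prems show ?case by (cases rule: exec.cases) (use IfFalse in blast)+
next
  case (WhileTrue e s c n1 s1 n2 s2)
  from WhileTrue.prems show ?case by (cases rule: exec.cases) (use WhileTrue in blast)+
qed (auto elim: exec.cases)

definition init_store :: "val \<Rightarrow> store" where
  "init_store v = (\<lambda>x. Num 0)(0 := v)"

text \<open>
  A single program must halt on the encoding \<open>enc I\<close> of every input \<open>I \<in> \<I>\<close> within time polynomial in
  the size of the encoding, with an output (the final content of variable 0) related to \<open>I\<close> by \<open>R\<close>.
\<close>

definition solvable_in_polytime ::
    "'i set \<Rightarrow> ('i \<Rightarrow> val) \<Rightarrow> ('i \<Rightarrow> val \<Rightarrow> bool) \<Rightarrow> bool" where
  "solvable_in_polytime \<I> enc R \<longleftrightarrow>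
     (\<exists>(P :: com) (p :: nat poly). \<forall>I\<in>\<I>. \<exists>n s.
        exec P (init_store (enc I)) n s \<and> n \<le> poly p (val_size (enc I)) \<and> R I (s 0))"


section \<open>Approximation algorithms\<close>

text \<open>
  Inputs to an algorithm are finite objects, so all distances and radii are rational. The points
  are \<open>0, \<dots>, npoints I - 1\<close>.
\<close>

record nukc_input =
  npoints :: nat
  distance :: "nat \<Rightarrow> nat \<Rightarrow> rat"
  radii :: "rat list"
  budgets :: "nat list"

record robust_input = nukc_input +
  target :: int

definition pts :: "('z) nukc_input_scheme \<Rightarrow> nat set" where
  "pts I = {..<npoints I}"

definition real_dist :: "('z) nukc_input_scheme \<Rightarrow> nat \<Rightarrow> nat \<Rightarrow> real" where
  "real_dist I x y = of_rat (distance I x y)"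

definition real_radii :: "('z) nukc_input_scheme \<Rightarrow> real list" where
  "real_radii I = map of_rat (radii I)"

definition valid_input :: "nat \<Rightarrow> ('z) nukc_input_scheme \<Rightarrow> bool" where
  "valid_input t I \<longleftrightarrow>
     Metric_space (pts I) (real_dist I) \<and>
     length (radii I) = t \<and> length (budgets I) = t \<and>
     sorted_wrt (\<ge>) (radii I) \<and> (\<forall>r\<in>set (radii I). 0 \<le> r)"

definition enc_list :: "('a \<Rightarrow> val) \<Rightarrow> 'a list \<Rightarrow> val" where
  "enc_list f xs = foldr (\<lambda>x v. Pair (f x) v) xs (Num 0)"

definition enc_nat :: "nat \<Rightarrow> val" where
  "enc_nat n = Num (int n)"

definition enc_rat :: "rat \<Rightarrow> val" where
  "enc_rat q = Pair (Num (fst (quotient_of q))) (Num (snd (quotient_of q)))"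

text \<open>The number of points, the distance matrix by rows, the radii and the budgets.\<close>

definition enc_nukc :: "('z) nukc_input_scheme \<Rightarrow> val" where
  "enc_nukc I =
     Pair (enc_nat (npoints I))
       (Pair (enc_list (\<lambda>x. enc_list (\<lambda>y. enc_rat (distance I x y)) [0..<npoints I]) [0..<npoints I])
         (Pair (enc_list enc_rat (radii I)) (enc_list enc_nat (budgets I))))"

definition enc_robust :: "robust_input \<Rightarrow> val" where
  "enc_robust I = Pair (Num (target I)) (enc_nukc I)"

text \<open>
  An output encodes center sets (as lists, order and repetitions being irrelevant) and a dilation
  factor (as a fraction, not necessarily in lowest terms).
\<close>

definition output_represents :: "val \<Rightarrow> nat set list \<Rightarrow> real \<Rightarrow> bool" where
  "output_represents v C \<beta> \<longleftrightarrow>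
     (\<exists>(L :: nat list list) (a :: int) (b :: int).
        v = Pair (enc_list (enc_list enc_nat) L) (Pair (Num a) (Num b)) \<and>
        C = map set L \<and> b > 0 \<and> \<beta> = real_of_int a / real_of_int b)"

text \<open>On an input that has no solution, an approximation algorithm may output anything.\<close>

definition nukc_approx_output :: "real \<Rightarrow> nukc_input \<Rightarrow> val \<Rightarrow> bool" where
  "nukc_approx_output \<alpha> I v \<longleftrightarrow>
     ((\<exists>C \<beta>. nukc_solution (pts I) (real_dist I) (real_radii I) (budgets I) C \<beta>) \<longrightarrow>
      (\<exists>C \<beta>. output_represents v C \<beta> \<and>
         nukc_solution (pts I) (real_dist I) (real_radii I) (budgets I) C \<beta> \<and>
         \<beta> \<le> \<alpha> * nukc_opt (pts I) (real_dist I) (real_radii I) (budgets I)))"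

definition robust_approx_output :: "real \<Rightarrow> robust_input \<Rightarrow> val \<Rightarrow> bool" where
  "robust_approx_output \<alpha> I v \<longleftrightarrow>
     ((\<exists>C \<beta>. robust_solution (pts I) (real_dist I) (real_radii I) (budgets I) (target I) C \<beta>) \<longrightarrow>
      (\<exists>C \<beta>. output_represents v C \<beta> \<and>
         robust_solution (pts I) (real_dist I) (real_radii I) (budgets I) (target I) C \<beta> \<and>
         \<beta> \<le> \<alpha> * robust_opt (pts I) (real_dist I) (real_radii I) (budgets I) (target I)))"

definition nukc_polytime_approximable :: "nat \<Rightarrow> real \<Rightarrow> bool" where
  "nukc_polytime_approximable t \<alpha> \<longleftrightarrow>
     solvable_in_polytime {I. valid_input t I} enc_nukc (nukc_approx_output \<alpha>)"

definition robust_polytime_approximable :: "nat \<Rightarrow> real \<Rightarrow> bool" where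
  "robust_polytime_approximable t \<alpha> \<longleftrightarrow>
     solvable_in_polytime {I. valid_input t I} enc_robust (robust_approx_output \<alpha>)"

end

theory Submission
  imports Defs
begin

text \<open>
  Suppose that the dilation factor \<open>\<gamma>\<close> is feasible, and choose greedily a maximal set \<open>P\<close> of points
  at pairwise distances greater than \<open>2\<gamma>r\<^sub>t\<close>. Each of the \<open>k\<^sub>t\<close> smallest balls contains at most one
  point of \<open>P\<close>, so the other balls cover at least \<open>|P| - k\<^sub>t\<close> points of \<open>P\<close>; recentering them at
  points of \<open>P\<close> doubles their radii. Hence the robust instance on \<open>P\<close> with the \<open>t - 1\<close> largest radii
  and target \<open>|P| - k\<^sub>t\<close> has optimum at most \<open>2\<gamma>\<close>, and the robust algorithm leaves at most \<open>k\<^sub>t\<close>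
  points of \<open>P\<close> uncovered at dilation \<open>2\<alpha>\<gamma>\<close>. These become the centers of the smallest balls, and
  since every point is within \<open>2\<gamma>r\<^sub>t\<close> of \<open>P\<close>, enlarging all balls by \<open>2\<gamma>r\<^sub>t\<close> covers the whole space.
  The best \<open>\<gamma>\<close> is 0 or of the form \<open>d(x,y)/r\<^sub>i\<close>, so all such values are tried. On a wrong guess the
  robust instance may have no solution, in which case the algorithm may return anything; such
  guesses are recognized and skipped.

  The algorithm runs in polynomial time because the functions computable in polynomial time on
  encodings are closed under composition, case distinction and folds over lists whose accumulator
  grows by a polynomial amount in each step.
\<close>

section \<open>Polynomial bounds\<close>

text \<open>In \<open>2 * \<alpha> + 2\<close> the first term is the doubling caused by recentering,
  passed through the robust algorithm; the second is the net radius. Recentering cannot be avoided: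
  centers must be points of the instance, and the instance must consist of net points only, since
  only among them does a smallest ball account for a single point.

  No test tells whether a guess was right, and none is needed: each accepted guess yields a genuine
  solution whose dilation factor is computed explicitly, so the best of these is at least as good as
  the one belonging to the right guess.

  Two obstacles are not geometric. The bound on the robust optimum is multiplied by \<alpha>, whose
  sign is not given; a two-point instance shows that it is nonnegative. And the answer to an
  unsolvable instance may not even have the shape of an output, so solvability is decided before the
  answer is read. The dilation factor being unbounded, this only requires a usable ball of positive
  radius or enough centers.\<close>

lemma poly_nat_mono: "a \<le> b \<Longrightarrow> poly p a \<le> poly p b" for p :: "nat poly"
  by (induction p) (auto intro: add_mono mult_mono)

text \<open>One polynomial serves the whole index set. Time bounds can thus be written in terms of
  intermediate sizes and are reduced to the input size \<open>A\<close> by the closure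
  rules.\<close>

definition poly_bounded :: "'i set \<Rightarrow> ('i \<Rightarrow> nat) \<Rightarrow> ('i \<Rightarrow> nat) \<Rightarrow> bool" where
  "poly_bounded S A T \<longleftrightarrow> (\<exists>p. \<forall>I\<in>S. T I \<le> poly p (A I))"

lemma poly_bounded_le:
  "poly_bounded S A T \<Longrightarrow> (\<And>I. I \<in> S \<Longrightarrow> T' I \<le> T I) \<Longrightarrow> poly_bounded S A T'"
  unfolding poly_bounded_def by (meson order_trans)

lemma poly_bounded_const: "poly_bounded S A (\<lambda>I. c)"
  unfolding poly_bounded_def by (rule exI[of _ "[:c:]"]) simp

lemma poly_bounded_self: "poly_bounded S A A"
  unfolding poly_bounded_def by (rule exI[of _ "[:0, 1:]"]) simp

lemma poly_bounded_add:
  assumes "poly_bounded S A T" "poly_bounded S A U"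
  shows "poly_bounded S A (\<lambda>I. T I + U I)"
proof -
  from assms obtain p q where "\<forall>I\<in>S. T I \<le> poly p (A I)" "\<forall>I\<in>S. U I \<le> poly q (A I)"
    unfolding poly_bounded_def by blast
  then have "\<forall>I\<in>S. T I + U I \<le> poly (p + q) (A I)" by (auto intro: add_mono)
  then show ?thesis unfolding poly_bounded_def by blast
qed

lemma poly_bounded_mult:
  assumes "poly_bounded S A T" "poly_bounded S A U"
  shows "poly_bounded S A (\<lambda>I. T I * U I)"
proof -
  from assms obtain p q where "\<forall>I\<in>S. T I \<le> poly p (A I)" "\<forall>I\<in>S. U I \<le> poly q (A I)"
    unfolding poly_bounded_def by blast
  then have "\<forall>I\<in>S. T I * U I \<le> poly (p * q) (A I)" by (auto intro: mult_mono)
  then show ?thesis unfolding poly_bounded_def by blast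
qed

lemma poly_bounded_poly:
  assumes "poly_bounded S A T"
  shows "poly_bounded S A (\<lambda>I. poly p (T I))"
proof -
  from assms obtain q where "\<forall>I\<in>S. T I \<le> poly q (A I)"
    unfolding poly_bounded_def by blast
  then have "\<forall>I\<in>S. poly p (T I) \<le> poly (pcompose p q) (A I)"
    by (auto simp: poly_pcompose intro: poly_nat_mono)
  then show ?thesis unfolding poly_bounded_def by blast
qed

lemmas poly_bounded_intros =
  poly_bounded_const poly_bounded_self poly_bounded_add poly_bounded_mult poly_bounded_poly


section \<open>Running programs\<close>

lemma bitlen_abs_le: "nat (bitlen \<bar>i\<bar>) \<le> w \<longleftrightarrow> \<bar>i\<bar> < 2 ^ w"
  by (simp add: bitlen_le_iff_power nat_le_iff)

lemma abs_less_bitlen: "\<bar>i\<bar> < 2 ^ nat (bitlen \<bar>i\<bar>)"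
  by (simp flip: bitlen_abs_le)

lemma val_size_int_of: "val_size (Num (int_of v)) \<le> val_size v"
  by (cases v) auto

text \<open>Bit lengths are turned into strict bounds by powers of two, for which the triangle
  inequality is available. Each power is estimated by the product of both, and doubling accounts for
  the carry bit.\<close>

lemma bitlen_abs_add:
  "nat (bitlen \<bar>i + j\<bar>) \<le> 1 + nat (bitlen \<bar>i\<bar>) + nat (bitlen \<bar>j\<bar>)"
proof -
  let ?a = "nat (bitlen \<bar>i\<bar>)" and ?b = "nat (bitlen \<bar>j\<bar>)"
  have "\<bar>i + j\<bar> < 2 ^ ?a + 2 ^ ?b"
    using abs_less_bitlen[of i] abs_less_bitlen[of j] by linarith
  also have "(2::int) ^ ?a \<le> 2 ^ (?a + ?b)" by (simp add: power_add)
  also have "(2::int) ^ ?b \<le> 2 ^ (?a + ?b)" by (simp add: power_add)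
  finally have "\<bar>i + j\<bar> < 2 ^ (1 + ?a + ?b)" by simp
  then show ?thesis by (simp only: bitlen_abs_le)
qed

lemma bitlen_abs_mult:
  "nat (bitlen \<bar>i * j\<bar>) \<le> nat (bitlen \<bar>i\<bar>) + nat (bitlen \<bar>j\<bar>)"
proof -
  have "\<bar>i * j\<bar> < 2 ^ (nat (bitlen \<bar>i\<bar>) + nat (bitlen \<bar>j\<bar>))"
    unfolding abs_mult power_add
    using abs_less_bitlen[of i] abs_less_bitlen[of j] by (intro mult_strict_mono) auto
  then show ?thesis by (simp only: bitlen_abs_le)
qed

text \<open>The carry bit costs nothing extra: the two operands contribute two units besides their
  bits, the sum only one.\<close>

lemma val_size_add: "val_size (Num (i + j)) \<le> val_size (Num i) + val_size (Num j)"
  using bitlen_abs_add[of i j] by simp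

lemma val_size_diff: "val_size (Num (i - j)) \<le> val_size (Num i) + val_size (Num j)"
  using bitlen_abs_add[of i "- j"] by simp

lemma val_size_mult: "val_size (Num (i * j)) \<le> val_size (Num i) + val_size (Num j)"
  using bitlen_abs_mult[of i j] by simp

lemma val_size_bool: "val_size (val_of_bool b) \<le> 2"
  by (auto simp: val_of_bool_def bitlen_alt_def)

lemma val_size_left: "val_size (left_of v) \<le> val_size v"
  by (cases v) auto

lemma val_size_right: "val_size (right_of v) \<le> val_size v"
  by (cases v) auto

fun expr_vars :: "expr \<Rightarrow> nat set" where
  "expr_vars (Var x) = {x}"
| "expr_vars (Const i) = {}"
| "expr_vars (MkPair a b) = expr_vars a \<union> expr_vars b"
| "expr_vars (Left a) = expr_vars a"
| "expr_vars (Right a) = expr_vars a"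
| "expr_vars (IsPair a) = expr_vars a"
| "expr_vars (Plus a b) = expr_vars a \<union> expr_vars b"
| "expr_vars (Minus a b) = expr_vars a \<union> expr_vars b"
| "expr_vars (Times a b) = expr_vars a \<union> expr_vars b"
| "expr_vars (Less a b) = expr_vars a \<union> expr_vars b"

lemma eval_expr_cong: "\<forall>x\<in>expr_vars e. s x = s' x \<Longrightarrow> eval_expr e s = eval_expr e s'"
  by (induction e) auto

lemma expr_cost_cong:
  assumes "\<forall>x\<in>expr_vars e. s x = s' x"
  shows "expr_cost e s = expr_cost e s'"
proof -
  have "subexprs_cost e s = subexprs_cost e s'" using assms
    by (induction e) (auto simp: ball_Un intro!: arg_cong2[where f = "(+)"] arg_cong[where f = val_size] eval_expr_cong)
  then show ?thesis using eval_expr_cong[OF assms] by simp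
qed

text \<open>Every operator yields a value at most 2 larger than its operands together. As the
  expression is fixed, its depth affects only the coefficients of the polynomial.\<close>

lemma expr_cost_bound:
  "\<exists>p. \<forall>s m. (\<forall>x\<in>expr_vars e. val_size (s x) \<le> m) \<longrightarrow> expr_cost e s \<le> poly p m"
proof (induction e)
  have binary: "\<exists>p. \<forall>s m. (\<forall>x\<in>expr_vars e. val_size (s x) \<le> m) \<longrightarrow> expr_cost e s \<le> poly p m"
    if p: "\<exists>p. \<forall>s m. (\<forall>x\<in>expr_vars a. val_size (s x) \<le> m) \<longrightarrow> expr_cost a s \<le> poly p m"
      and q: "\<exists>p. \<forall>s m. (\<forall>x\<in>expr_vars b. val_size (s x) \<le> m) \<longrightarrow> expr_cost b s \<le> poly p m"
      and e: "expr_vars e = expr_vars a \<union> expr_vars b"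
        "\<And>s. subexprs_cost e s \<le> expr_cost a s + expr_cost b s"
        "\<And>s. val_size (eval_expr e s) \<le> 2 + val_size (eval_expr a s) + val_size (eval_expr b s)"
    for a b e
  proof -
    from p q obtain p q
      where p: "\<And>s m. (\<forall>x\<in>expr_vars a. val_size (s x) \<le> m) \<Longrightarrow> expr_cost a s \<le> poly p m"
        and q: "\<And>s m. (\<forall>x\<in>expr_vars b. val_size (s x) \<le> m) \<Longrightarrow> expr_cost b s \<le> poly q m"
      by blast
    \<comment> \<open>The operands' values are already charged in the operands' costs, so bounding
      the result by 2 plus these values at most doubles the costs.\<close>
    have "expr_cost e s \<le> poly ([:2:] + [:2:] * (p + q)) m"
      if m: "\<forall>x\<in>expr_vars e. val_size (s x) \<le> m" for s m
    proof -
      have "expr_cost a s \<le> poly p m" "expr_cost b s \<le> poly q m"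
        using p[of s m] q[of s m] m e(1) by simp_all
      then show ?thesis
        using e(3)[of s] e(2)[of s] by simp
    qed
    then show ?thesis by blast
  qed
  \<comment> \<open>A unary operator is treated as a binary one with its operand repeated.\<close>
  have unary: "\<exists>p. \<forall>s m. (\<forall>x\<in>expr_vars e. val_size (s x) \<le> m) \<longrightarrow> expr_cost e s \<le> poly p m"
    if p: "\<exists>p. \<forall>s m. (\<forall>x\<in>expr_vars a. val_size (s x) \<le> m) \<longrightarrow> expr_cost a s \<le> poly p m"
      and e: "expr_vars e = expr_vars a"
        "\<And>s. subexprs_cost e s = expr_cost a s"
        "\<And>s. val_size (eval_expr e s) \<le> 2 + val_size (eval_expr a s)"
    for a e
    by (rule binary[OF p p]) (use e in \<open>auto intro: le_trans[OF e(3)]\<close>)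
  {
    case (Var x)
    show ?case by (rule exI[of _ "[:0, 1:]"]) simp
  next
    case (Const i)
    show ?case by (rule exI[of _ "[:val_size (Num i):]"]) simp
  next
    case (MkPair a b)
    then show ?case by (rule binary) auto
  next
    case (Left a)
    then show ?case by (rule unary) (auto intro: le_trans[OF val_size_left])
  next
    case (Right a)
    then show ?case by (rule unary) (auto intro: le_trans[OF val_size_right])
  next
    case (IsPair a)
    then show ?case by (rule unary) (auto intro: le_trans[OF val_size_bool])
  next
    case (Plus a b)
    show ?case
      by (rule binary[OF Plus])
        (auto intro!: le_trans[OF val_size_add] le_trans[OF add_mono[OF val_size_int_of val_size_int_of]]
          simp del: val_size.simps)
  next
    case (Minus a b)
    show ?case
      by (rule binary[OF Minus])
        (auto intro!: le_trans[OF val_size_diff] le_trans[OF add_mono[OF val_size_int_of val_size_int_of]]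
          simp del: val_size.simps)
  next
    case (Times a b)
    show ?case
      by (rule binary[OF Times])
        (auto intro!: le_trans[OF val_size_mult] le_trans[OF add_mono[OF val_size_int_of val_size_int_of]]
          simp del: val_size.simps)
  next
    case (Less a b)
    then show ?case by (rule binary) (auto intro: le_trans[OF val_size_bool])
  }
qed

section \<open>Variables of a program and the frame property\<close>

fun com_vars :: "com \<Rightarrow> nat set" where
  "com_vars SKIP = {}"
| "com_vars (Assign x e) = insert x (expr_vars e)"
| "com_vars (Seq c1 c2) = com_vars c1 \<union> com_vars c2"
| "com_vars (IF e c1 c2) = expr_vars e \<union> com_vars c1 \<union> com_vars c2"
| "com_vars (WHILE e c) = expr_vars e \<union> com_vars c"

lemma finite_expr_vars: "finite (expr_vars e)"
  by (induction e) auto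

lemma finite_com_vars: "finite (com_vars c)"
  by (induction c) (auto simp: finite_expr_vars)

lemma holds_cong: "\<forall>x\<in>expr_vars e. s x = s' x \<Longrightarrow> holds e s = holds e s'"
  using eval_expr_cong[of e s s'] by (simp add: holds_def)

text \<open>This makes subroutines possible: a run known from a fresh store can be repeated in the
  middle of another computation, in the same time, while the caller keeps its data outside
  \<open>V\<close>. Allowing \<open>V\<close> to exceed the variables of \<open>c\<close> lets one
  initial segment serve several programs.\<close>

lemma exec_frame:
  assumes "exec c s n s'" "com_vars c \<subseteq> V" "\<forall>x\<in>V. u x = s x"
  shows "\<exists>u'. exec c u n u' \<and> (\<forall>x\<in>V. u' x = s' x) \<and> (\<forall>x. x \<notin> V \<longrightarrow> u' x = u x)"
  using assms
proof (induction arbitrary: u rule: exec.induct)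
  case (Skip s)
  then show ?case by (blast intro: exec.Skip)
next
  case (Assign x e s)
  then have "\<forall>x\<in>expr_vars e. u x = s x" by auto
  then have "eval_expr e u = eval_expr e s" "expr_cost e u = expr_cost e s"
    by (rule eval_expr_cong, rule expr_cost_cong)
  with exec.Assign[of x e u]
  have "exec (Assign x e) u (1 + expr_cost e s) (u(x := eval_expr e s))" by simp
  then show ?case using Assign by (intro exI conjI) auto
next
  case (Seq c1 s n1 s1 c2 n2 s2)
  then have V: "com_vars c1 \<subseteq> V" "com_vars c2 \<subseteq> V" by auto
  from Seq.IH(1)[OF V(1) Seq.prems(2)] obtain u1
    where 1: "exec c1 u n1 u1" "\<forall>x\<in>V. u1 x = s1 x" "\<forall>x. x \<notin> V \<longrightarrow> u1 x = u x"
    by blast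
  from Seq.IH(2)[OF V(2) 1(2)] obtain u2
    where 2: "exec c2 u1 n2 u2" "\<forall>x\<in>V. u2 x = s2 x" "\<forall>x. x \<notin> V \<longrightarrow> u2 x = u1 x"
    by blast
  from 1(3) 2(3) have "\<forall>x. x \<notin> V \<longrightarrow> u2 x = u x" by simp
  with exec.Seq[OF 1(1) 2(1)] 2(2) show ?case by blast
next
  case (IfTrue e s c1 n s' c2)
  then have V: "com_vars c1 \<subseteq> V" and e: "\<forall>x\<in>expr_vars e. u x = s x" by auto
  from IfTrue.IH[OF V IfTrue.prems(2)] exec.IfTrue[of e u c1 n _ c2] IfTrue.hyps(1) show ?case
    unfolding holds_cong[OF e] expr_cost_cong[OF e] by blast
next
  case (IfFalse e s c2 n s' c1)
  then have V: "com_vars c2 \<subseteq> V" and e: "\<forall>x\<in>expr_vars e. u x = s x" by auto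
  from IfFalse.IH[OF V IfFalse.prems(2)] exec.IfFalse[of e u c2 n _ c1] IfFalse.hyps(1) show ?case
    unfolding holds_cong[OF e] expr_cost_cong[OF e] by blast
next
  case (WhileFalse e s c)
  then have e: "\<forall>x\<in>expr_vars e. u x = s x" by auto
  with exec.WhileFalse[of e u c] WhileFalse show ?case
    unfolding holds_cong[OF e] expr_cost_cong[OF e] by blast
next
  case (WhileTrue e s c n1 s1 n2 s2)
  then have V: "com_vars c \<subseteq> V" and e: "\<forall>x\<in>expr_vars e. u x = s x" by auto
  from WhileTrue.IH(1)[OF V WhileTrue.prems(2)] obtain u1
    where 1: "exec c u n1 u1" "\<forall>x\<in>V. u1 x = s1 x" "\<forall>x. x \<notin> V \<longrightarrow> u1 x = u x"
    by blast
  from WhileTrue.IH(2)[OF WhileTrue.prems(1) 1(2)] obtain u2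
    where 2: "exec (WHILE e c) u1 n2 u2" "\<forall>x\<in>V. u2 x = s2 x" "\<forall>x. x \<notin> V \<longrightarrow> u2 x = u1 x"
    by blast
  from 1(3) 2(3) have "\<forall>x. x \<notin> V \<longrightarrow> u2 x = u x" by simp
  with exec.WhileTrue[of e u c n1 u1 n2 u2] 1(1) 2(1,2) WhileTrue.hyps(1) show ?case
    unfolding holds_cong[OF e] expr_cost_cong[OF e] by blast
qed

text \<open>An assignment is charged at least the size of the value it stores, so no variable grows
  faster than the clock.\<close>

lemma exec_val_size: "exec c s n s' \<Longrightarrow> val_size (s' x) \<le> val_size (s x) + n"
  by (induction rule: exec.induct) auto

section \<open>Total correctness with time bounds\<close>

definition runs :: "com \<Rightarrow> store \<Rightarrow> nat \<Rightarrow> (store \<Rightarrow> bool) \<Rightarrow> bool" where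
  "runs c s T Q \<longleftrightarrow> (\<exists>n s'. exec c s n s' \<and> n \<le> T \<and> Q s')"

lemma runs_Assign:
  "1 + expr_cost e s \<le> T \<Longrightarrow> Q (s(x := eval_expr e s)) \<Longrightarrow> runs (Assign x e) s T Q"
  unfolding runs_def using exec.Assign by blast

lemma runs_Seq:
  assumes "runs c1 s T1 R" "\<And>s1. R s1 \<Longrightarrow> runs c2 s1 T2 Q" "1 + T1 + T2 \<le> T"
  shows "runs (Seq c1 c2) s T Q"
proof -
  from assms(1) obtain n1 s1 where 1: "exec c1 s n1 s1" "n1 \<le> T1" "R s1"
    unfolding runs_def by blast
  with assms(2) obtain n2 s2 where "exec c2 s1 n2 s2" "n2 \<le> T2" "Q s2"
    unfolding runs_def by blast
  with 1 assms(3) show ?thesis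
    unfolding runs_def
    by (intro exI[of _ "1 + n1 + n2"] exI[of _ s2] conjI exec.Seq[of c1 s n1 s1 c2 n2 s2]) auto
qed

lemma runs_IF:
  assumes "holds e s \<Longrightarrow> runs c1 s T1 Q" "\<not> holds e s \<Longrightarrow> runs c2 s T1 Q"
    "1 + expr_cost e s + T1 \<le> T"
  shows "runs (IF e c1 c2) s T Q"
proof (cases "holds e s")
  case True
  with assms(1) obtain n s' where "exec c1 s n s'" "n \<le> T1" "Q s'"
    unfolding runs_def by blast
  with exec.IfTrue[OF True this(1), of c2] assms(3) show ?thesis
    unfolding runs_def by (meson add_left_mono le_trans)
next
  case False
  with assms(2) obtain n s' where "exec c2 s n s'" "n \<le> T1" "Q s'"
    unfolding runs_def by blast
  with exec.IfFalse[OF False this(1), of c1] assms(3) show ?thesis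
    unfolding runs_def by (meson add_left_mono le_trans)
qed

lemma runs_weaken: "runs c s T Q \<Longrightarrow> T \<le> T' \<Longrightarrow> (\<And>s. Q s \<Longrightarrow> Q' s) \<Longrightarrow> runs c s T' Q'"
  unfolding runs_def by (meson le_trans)

text \<open>The index of the invariant counts the iterations still to come; it decides the guard and
  gives termination. The factor \<open>k + 1\<close> includes the final failing test.\<close>

lemma runs_WHILE:
  fixes Inv :: "nat \<Rightarrow> store \<Rightarrow> bool"
  assumes "Inv k s"
    and "\<And>j s. Inv (Suc j) s \<Longrightarrow> holds e s \<and> expr_cost e s \<le> C \<and> runs c s T (Inv j)"
    and "\<And>s. Inv 0 s \<Longrightarrow> \<not> holds e s \<and> expr_cost e s \<le> C"
  shows "runs (WHILE e c) s ((k + 1) * (1 + C + T)) (Inv 0)"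
  using assms(1)
proof (induction k arbitrary: s)
  case 0
  with assms(3)[OF 0] exec.WhileFalse[of e s c] show ?case
    unfolding runs_def by (intro exI[of _ "1 + expr_cost e s"] exI[of _ s]) auto
next
  case (Suc k)
  from assms(2)[OF Suc.prems] obtain n1 s1
    where 1: "holds e s" "expr_cost e s \<le> C" "exec c s n1 s1" "n1 \<le> T" "Inv k s1"
    unfolding runs_def by blast
  from Suc.IH[OF 1(5)] obtain n2 s2
    where 2: "exec (WHILE e c) s1 n2 s2" "n2 \<le> (k + 1) * (1 + C + T)" "Inv 0 s2"
    unfolding runs_def by blast
  have "1 + expr_cost e s + n1 + n2 \<le> (Suc k + 1) * (1 + C + T)"
    using 1(2,4) 2(2) by simp
  with exec.WhileTrue[OF 1(1,3) 2(1)] 2(3) show ?case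
    unfolding runs_def by blast
qed

text \<open>Programs are known to work only when all variables other than 0 initially contain
  \<open>Num 0\<close>, which has to be restored in a used store. Variable 0 is spared because it
  carries the argument.\<close>

fun clear :: "nat \<Rightarrow> com" where
  "clear 0 = SKIP"
| "clear (Suc N) = Seq (clear N) (Assign (Suc N) (Const 0))"

lemma runs_clear:
  "runs (clear N) s (1 + 4 * N) (\<lambda>s'. \<forall>x. s' x = (if 0 < x \<and> x \<le> N then Num 0 else s x))"
proof (induction N)
  case 0
  show ?case unfolding runs_def using exec.Skip by auto
next
  case (Suc N)
  show ?case unfolding clear.simps
  proof (rule runs_Seq[OF Suc])
    fix s1
    assume s1: "\<forall>x. s1 x = (if 0 < x \<and> x \<le> N then Num 0 else s x)"
    show "runs (Assign (Suc N) (Const 0)) s1 2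
        (\<lambda>s'. \<forall>x. s' x = (if 0 < x \<and> x \<le> Suc N then Num 0 else s x))"
      by (rule runs_Assign) (use s1 in \<open>simp_all add: le_Suc_eq\<close>)
  qed simp
qed

text \<open>Runs \<open>P\<close>, whose variables are at most \<open>N\<close>, on the value of \<open>a\<close>; the variables above \<open>N\<close> survive.\<close>

definition call :: "nat \<Rightarrow> com \<Rightarrow> expr \<Rightarrow> com" where
  "call N P a = Seq (Assign 0 a) (Seq (clear N) P)"

lemma runs_call:
  assumes N: "com_vars P \<subseteq> {..N}"
    and P: "runs P (init_store v) T (\<lambda>s'. s' 0 = w)"
    and v: "eval_expr a s = v"
    and T': "T + expr_cost a s + 4 * N + 4 \<le> T'"
  shows "runs (call N P a) s T' (\<lambda>s'. s' 0 = w \<and> (\<forall>x>N. s' x = s x))"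
proof -
  have *: "runs P s1 T (\<lambda>s'. s' 0 = w \<and> (\<forall>x>N. s' x = s x))"
    if s1: "\<forall>x. s1 x = (if 0 < x \<and> x \<le> N then Num 0 else (s(0 := v)) x)" for s1
  proof -
    from P obtain n s' where n: "exec P (init_store v) n s'" "n \<le> T" "s' 0 = w"
      unfolding runs_def by blast
    \<comment> \<open>After clearing, the store looks fresh on every variable that \<open>P\<close>
      can touch, so the frame property transfers the run.\<close>
    have "\<forall>x\<in>{..N}. s1 x = init_store v x"
      using s1 by (auto simp: init_store_def)
    from exec_frame[OF n(1) N this] obtain u
      where u: "exec P s1 n u" "\<forall>x\<in>{..N}. u x = s' x" "\<forall>x. x \<notin> {..N} \<longrightarrow> u x = s1 x"
      by blast
    then have "u 0 = w" "\<forall>x>N. u x = s x" using n(3) s1 by auto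
    with u(1) n(2) show ?thesis unfolding runs_def by blast
  qed
  have "runs (Seq (clear N) P) (s(0 := v)) (2 + 4 * N + T) (\<lambda>s'. s' 0 = w \<and> (\<forall>x>N. s' x = s x))"
    using runs_Seq[OF runs_clear[of N "s(0 := v)"] *] by simp
  then have 2: "\<And>s1. s1 = s(0 := v) \<Longrightarrow>
      runs (Seq (clear N) P) s1 (2 + 4 * N + T) (\<lambda>s'. s' 0 = w \<and> (\<forall>x>N. s' x = s x))"
    by simp
  have 1: "runs (Assign 0 a) s (1 + expr_cost a s) (\<lambda>s'. s' = s(0 := v))"
    by (rule runs_Assign) (simp_all add: v)
  show ?thesis
    unfolding call_def by (rule runs_Seq[OF 1 2]) (use T' in auto)
qed

section \<open>Polynomial-time functions\<close>

text \<open>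
  The index \<open>I \<in> S\<close> plays the role of a context whose encoding \<open>e I\<close> is the input; a nested loop
  body is a function on a context extended by the loop variables.
\<close>

definition polytime :: "'i set \<Rightarrow> ('i \<Rightarrow> val) \<Rightarrow> ('i \<Rightarrow> val) \<Rightarrow> bool" where
  "polytime S e f \<longleftrightarrow> solvable_in_polytime S e (\<lambda>I v. v = f I)"

definition ext :: "('i \<Rightarrow> val) \<Rightarrow> ('a \<Rightarrow> val) \<Rightarrow> 'i \<times> 'a \<Rightarrow> val" where
  "ext e ea z = Pair (e (fst z)) (ea (snd z))"

lemma polytimeI:
  assumes "poly_bounded S (\<lambda>I. val_size (e I)) T"
    and "\<And>I. I \<in> S \<Longrightarrow> runs P (init_store (e I)) (T I) (\<lambda>s. s 0 = f I)"
  shows "polytime S e f"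
proof -
  from assms(1) obtain p where p: "\<forall>I\<in>S. T I \<le> poly p (val_size (e I))"
    unfolding poly_bounded_def by blast
  have "\<exists>n s. exec P (init_store (e I)) n s \<and> n \<le> poly p (val_size (e I)) \<and> s 0 = f I"
    if "I \<in> S" for I
    using assms(2)[OF that] p that unfolding runs_def by (meson le_trans)
  then show ?thesis unfolding polytime_def solvable_in_polytime_def by blast
qed

lemma polytimeE:
  assumes "polytime S e f"
  obtains P p where
    "\<And>I. I \<in> S \<Longrightarrow> runs P (init_store (e I)) (poly p (val_size (e I))) (\<lambda>s. s 0 = f I)"
  using assms unfolding polytime_def solvable_in_polytime_def runs_def by blast

text \<open>Variables above the common bound serve as registers for a program that calls all members
  of \<open>C\<close>.\<close>

lemma com_vars_bound: "finite C \<Longrightarrow> \<exists>N. \<forall>P\<in>C. com_vars P \<subseteq> {..N}"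
proof -
  assume "finite C"
  then have "finite (\<Union>P\<in>C. com_vars P)" using finite_com_vars by blast
  then obtain N where "(\<Union>P\<in>C. com_vars P) \<subseteq> {..N}"
    using finite_nat_iff_bounded_le by blast
  then show ?thesis by blast
qed

text \<open>The output exceeds the input by at most the running time. Sizes of intermediate results
  may therefore enter later time bounds.\<close>

lemma polytime_size:
  assumes "polytime S e f"
  shows "poly_bounded S (\<lambda>I. val_size (e I)) (\<lambda>I. val_size (f I))"
proof -
  from assms obtain P p where
    P: "\<And>I. I \<in> S \<Longrightarrow> runs P (init_store (e I)) (poly p (val_size (e I))) (\<lambda>s. s 0 = f I)"
    by (rule polytimeE) blast
  have "val_size (f I) \<le> val_size (e I) + poly p (val_size (e I))" if "I \<in> S" for I
    using P[OF that] exec_val_size[of P "init_store (e I)" _ _ 0] unfolding runs_def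
    by (fastforce simp: init_store_def)
  then show ?thesis
    by (intro poly_bounded_le[OF poly_bounded_add[OF poly_bounded_self poly_bounded_poly[OF poly_bounded_self]]])
qed

lemma polytime_cong: "polytime S e f \<Longrightarrow> (\<And>I. I \<in> S \<Longrightarrow> f I = g I) \<Longrightarrow> polytime S e g"
  unfolding polytime_def solvable_in_polytime_def by simp

lemma polytime_subset: "polytime S e f \<Longrightarrow> S' \<subseteq> S \<Longrightarrow> polytime S' e f"
  unfolding polytime_def solvable_in_polytime_def by blast

text \<open>Composition through codes: \<open>f I\<close> is the code of the index
  \<open>h I\<close> on which the second program runs, and \<open>h I\<close> itself may be any
  abstract object. The code has polynomial size, so inserting it into the second time bound keeps
  the bound polynomial.\<close>

lemma polytime_comp:
  assumes "polytime S e f" "polytime T d g"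
    and h: "\<And>I. I \<in> S \<Longrightarrow> h I \<in> T" "\<And>I. I \<in> S \<Longrightarrow> f I = d (h I)"
  shows "polytime S e (\<lambda>I. g (h I))"
proof -
  from assms(1) obtain P p where
    P: "\<And>I. I \<in> S \<Longrightarrow> runs P (init_store (e I)) (poly p (val_size (e I))) (\<lambda>s. s 0 = f I)"
    by (rule polytimeE) blast
  from assms(2) obtain Q q where
    Q: "\<And>I. I \<in> T \<Longrightarrow> runs Q (init_store (d I)) (poly q (val_size (d I))) (\<lambda>s. s 0 = g I)"
    by (rule polytimeE) blast
  obtain N where N: "com_vars Q \<subseteq> {..N}"
    using com_vars_bound[of "{Q}"] by auto
  show ?thesis
  proof (rule polytimeI)
    fix I assume I: "I \<in> S"
    show "runs (Seq P (call N Q (Var 0))) (init_store (e I))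
        (1 + poly p (val_size (e I)) + (poly q (val_size (f I)) + val_size (f I) + 4 * N + 4))
        (\<lambda>s. s 0 = g (h I))"
    proof (rule runs_Seq[OF P[OF I] _ order_refl])
      fix s :: store assume s: "s 0 = f I"
      have "runs (call N Q (Var 0)) s (poly q (val_size (f I)) + val_size (f I) + 4 * N + 4)
          (\<lambda>s'. s' 0 = g (h I) \<and> (\<forall>x>N. s' x = s x))"
        using Q[of "h I"] h I s by (intro runs_call[OF N, of "f I"]) auto
      then show "runs (call N Q (Var 0)) s (poly q (val_size (f I)) + val_size (f I) + 4 * N + 4)
          (\<lambda>s. s 0 = g (h I))"
        by (rule runs_weaken) auto
    qed
  qed (intro poly_bounded_intros polytime_size[OF assms(1)])
qed

lemma polytime_self: "polytime S e e"
proof (rule polytimeI[OF poly_bounded_const])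
  show "runs SKIP (init_store (e I)) 1 (\<lambda>s. s 0 = e I)" for I
    unfolding runs_def by (intro exI conjI, rule exec.Skip) (auto simp: init_store_def)
qed

lemma polytime_expr:
  assumes "polytime S e f" "expr_vars E \<subseteq> {0}"
  shows "polytime S e (\<lambda>I. eval_expr E (init_store (f I)))"
proof (rule polytime_comp[where h = f, OF assms(1)])
  from expr_cost_bound[of E] obtain p
    where p: "\<And>s m. (\<forall>x\<in>expr_vars E. val_size (s x) \<le> m) \<Longrightarrow> expr_cost E s \<le> poly p m"
    by blast
  \<comment> \<open>Values are taken as their own codes; the expression then is a function of an
    arbitrary value, to be composed with \<open>f\<close>.\<close>
  show "polytime UNIV (\<lambda>v. v) (\<lambda>v. eval_expr E (init_store v))"
  proof (rule polytimeI)
    fix v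
    have "expr_cost E (init_store v) \<le> poly p (val_size v)"
      using assms(2) by (intro p) (auto simp: init_store_def)
    then show "runs (Assign 0 E) (init_store v) (1 + poly p (val_size v))
        (\<lambda>s. s 0 = eval_expr E (init_store v))"
      by (intro runs_Assign) auto
  qed (intro poly_bounded_intros)
qed auto

lemma polytime_Pair:
  assumes "polytime S e f" "polytime S e g"
  shows "polytime S e (\<lambda>I. Pair (f I) (g I))"
proof -
  from assms(1) obtain P p where
    P: "\<And>I. I \<in> S \<Longrightarrow> runs P (init_store (e I)) (poly p (val_size (e I))) (\<lambda>s. s 0 = f I)"
    by (rule polytimeE) blast
  from assms(2) obtain Q q where
    Q: "\<And>I. I \<in> S \<Longrightarrow> runs Q (init_store (e I)) (poly q (val_size (e I))) (\<lambda>s. s 0 = g I)"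
    by (rule polytimeE) blast
  obtain N where N: "com_vars P \<subseteq> {..N}" "com_vars Q \<subseteq> {..N}"
    using com_vars_bound[of "{P, Q}"] by auto
  \<comment> \<open>Calls overwrite everything up to \<open>N\<close>. Register \<open>a\<close>
    keeps the input for the second call and \<open>b\<close> the result of the first.\<close>
  define a b where "a = Suc N" and "b = Suc (Suc N)"
  show ?thesis
  proof (rule polytimeI)
    fix I assume I: "I \<in> S"
    let ?E = "val_size (e I)" and ?F = "val_size (f I)" and ?G = "val_size (g I)"
    have 1: "runs (Assign a (Var 0)) (init_store (e I)) (1 + ?E) (\<lambda>s. s a = e I)"
      by (rule runs_Assign) (auto simp: init_store_def)
    have 2: "runs (call N P (Var a)) s (poly p ?E + ?E + 4 * N + 4)
        (\<lambda>s'. s' 0 = f I \<and> (\<forall>x>N. s' x = s x))" if "s a = e I" for s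
      using that by (intro runs_call[OF N(1) P[OF I]]) auto
    have 3: "runs (Assign b (Var 0)) s (1 + ?F) (\<lambda>s. s a = e I \<and> s b = f I)"
      if "s 0 = f I" "s a = e I" for s
      using that by (intro runs_Assign) (auto simp: a_def b_def)
    have 4: "runs (call N Q (Var a)) s (poly q ?E + ?E + 4 * N + 4)
        (\<lambda>s'. s' 0 = g I \<and> (\<forall>x>N. s' x = s x))" if "s a = e I" for s
      using that by (intro runs_call[OF N(2) Q[OF I]]) auto
    have 5: "runs (Assign 0 (MkPair (Var b) (Var 0))) s (2 + 2 * (?F + ?G))
        (\<lambda>s. s 0 = Pair (f I) (g I))" if "s 0 = g I" "s b = f I" for s
      using that by (intro runs_Assign) auto
    have 45: "runs (Seq (call N Q (Var a)) (Assign 0 (MkPair (Var b) (Var 0)))) s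
        (1 + (poly q ?E + ?E + 4 * N + 4) + (2 + 2 * (?F + ?G)))
        (\<lambda>s. s 0 = Pair (f I) (g I))" if "s a = e I" "s b = f I" for s
      by (rule runs_Seq[OF 4[of s, OF that(1)] 5 order_refl]) (use that in \<open>auto simp: b_def\<close>)
    show "runs (Seq (Assign a (Var 0)) (Seq (call N P (Var a)) (Seq (Assign b (Var 0))
          (Seq (call N Q (Var a)) (Assign 0 (MkPair (Var b) (Var 0)))))))
        (init_store (e I))
        (1 + (1 + ?E) + (1 + (poly p ?E + ?E + 4 * N + 4) + (1 + (1 + ?F) +
          (1 + (poly q ?E + ?E + 4 * N + 4) + (2 + 2 * (?F + ?G))))))
        (\<lambda>s. s 0 = Pair (f I) (g I))"
      by (rule runs_Seq[OF 1 _ order_refl], rule runs_Seq[OF 2 _ order_refl], assumption,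
          rule runs_Seq[OF 3 45 order_refl])
        (auto simp: a_def)
  qed (intro poly_bounded_intros polytime_size[OF assms(1)] polytime_size[OF assms(2)])
qed

lemma polytime_If:
  assumes "polytime S e (\<lambda>I. val_of_bool (c I))" "polytime S e f" "polytime S e g"
  shows "polytime S e (\<lambda>I. if c I then f I else g I)"
proof -
  from assms(1) obtain C c' where
    C: "\<And>I. I \<in> S \<Longrightarrow> runs C (init_store (e I)) (poly c' (val_size (e I))) (\<lambda>s. s 0 = val_of_bool (c I))"
    by (rule polytimeE) blast
  from assms(2) obtain P p where
    P: "\<And>I. I \<in> S \<Longrightarrow> runs P (init_store (e I)) (poly p (val_size (e I))) (\<lambda>s. s 0 = f I)"
    by (rule polytimeE) blast
  from assms(3) obtain Q q where
    Q: "\<And>I. I \<in> S \<Longrightarrow> runs Q (init_store (e I)) (poly q (val_size (e I))) (\<lambda>s. s 0 = g I)"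
    by (rule polytimeE) blast
  obtain N where N: "com_vars C \<subseteq> {..N}" "com_vars P \<subseteq> {..N}" "com_vars Q \<subseteq> {..N}"
    using com_vars_bound[of "{C, P, Q}"] by auto
  define a where "a = Suc N"
  show ?thesis
  proof (rule polytimeI)
    fix I assume I: "I \<in> S"
    let ?E = "val_size (e I)"
    \<comment> \<open>The sum of the two budgets bounds either branch, in place of their
      maximum.\<close>
    let ?T = "(poly p ?E + ?E + 4 * N + 4) + (poly q ?E + ?E + 4 * N + 4)"
    have 1: "runs (Assign a (Var 0)) (init_store (e I)) (1 + ?E) (\<lambda>s. s a = e I)"
      by (rule runs_Assign) (auto simp: init_store_def)
    have 2: "runs (call N C (Var a)) s (poly c' ?E + ?E + 4 * N + 4)
        (\<lambda>s'. s' 0 = val_of_bool (c I) \<and> (\<forall>x>N. s' x = s x))" if "s a = e I" for s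
      using that by (intro runs_call[OF N(1) C[OF I]]) auto
    have 3: "runs (call N P (Var a)) s ?T
        (\<lambda>s'. s' 0 = f I \<and> (\<forall>x>N. s' x = s x))" if "s a = e I" for s
      using that by (intro runs_call[OF N(2) P[OF I]]) auto
    have 4: "runs (call N Q (Var a)) s ?T
        (\<lambda>s'. s' 0 = g I \<and> (\<forall>x>N. s' x = s x))" if "s a = e I" for s
      using that by (intro runs_call[OF N(3) Q[OF I]]) auto
    have 5: "runs (IF (Var 0) (call N P (Var a)) (call N Q (Var a))) s (3 + ?T)
        (\<lambda>s. s 0 = (if c I then f I else g I))" if "s 0 = val_of_bool (c I)" "s a = e I" for s
    proof (rule runs_IF)
      show "runs (call N P (Var a)) s ?T (\<lambda>s. s 0 = (if c I then f I else g I))" if "holds (Var 0) s"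
        by (rule runs_weaken[OF 3[of s]])
          (use that \<open>s 0 = _\<close> \<open>s a = e I\<close> in \<open>auto simp: holds_def val_of_bool_def split: if_splits\<close>)
      show "runs (call N Q (Var a)) s ?T (\<lambda>s. s 0 = (if c I then f I else g I))" if "\<not> holds (Var 0) s"
        by (rule runs_weaken[OF 4[of s]])
          (use that \<open>s 0 = _\<close> \<open>s a = e I\<close> in \<open>auto simp: holds_def val_of_bool_def split: if_splits\<close>)
      show "1 + expr_cost (Var 0) s + ?T \<le> 3 + ?T"
        using val_size_bool[of "c I"] \<open>s 0 = _\<close> by simp
    qed
    show "runs (Seq (Assign a (Var 0)) (Seq (call N C (Var a))
          (IF (Var 0) (call N P (Var a)) (call N Q (Var a)))))
        (init_store (e I))
        (1 + (1 + ?E) + (1 + (poly c' ?E + ?E + 4 * N + 4) + (3 + ?T)))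
        (\<lambda>s. s 0 = (if c I then f I else g I))"
      by (rule runs_Seq[OF 1 _ order_refl], rule runs_Seq[OF 2 _ order_refl], assumption, rule 5)
        (auto simp: a_def)
  qed (intro poly_bounded_intros)
qed

section \<open>Folds over encoded lists\<close>

lemma enc_list_simps [simp]:
  "enc_list ea [] = Num 0"
  "enc_list ea (x # xs) = Pair (ea x) (enc_list ea xs)"
  by (simp_all add: enc_list_def)

lemma val_size_enc_list: "val_size (enc_list ea xs) = 1 + length xs + (\<Sum>x\<leftarrow>xs. val_size (ea x))"
  by (induction xs) auto

lemma length_le_val_size: "length xs \<le> val_size (enc_list ea xs)"
  by (simp add: val_size_enc_list)

lemma elem_val_size: "x \<in> set xs \<Longrightarrow> val_size (ea x) \<le> val_size (enc_list ea xs)"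
  by (induction xs) auto

text \<open>Polynomially many polynomial-time steps do not suffice: an accumulator doubling in size
  at every step would become exponential. Hence the bound \<open>B\<close> on all intermediate
  accumulators. The set \<open>T\<close> restricts the step to arguments that actually occur, so
  invariants of the accumulator can be used there.\<close>

lemma polytime_fold_bounded:
  fixes g :: "'i \<Rightarrow> 'a \<Rightarrow> 'b \<Rightarrow> 'b"
  assumes xs: "polytime S e (\<lambda>I. enc_list ea (xs I))"
    and b0: "polytime S e (\<lambda>I. eb (b0 I))"
    and step: "polytime T (ext (ext e ea) eb) (\<lambda>z. eb (g (fst (fst z)) (snd (fst z)) (snd z)))"
    and T: "\<And>I j. I \<in> S \<Longrightarrow> j < length (xs I) \<Longrightarrow>
      ((I, xs I ! j), fold (g I) (take j (xs I)) (b0 I)) \<in> T"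
    and B: "poly_bounded S (\<lambda>I. val_size (e I)) B"
      "\<And>I j. I \<in> S \<Longrightarrow> j \<le> length (xs I) \<Longrightarrow>
        val_size (eb (fold (g I) (take j (xs I)) (b0 I))) \<le> B I"
  shows "polytime S e (\<lambda>I. eb (fold (g I) (xs I) (b0 I)))"
proof -
  from xs obtain P p where
    P: "\<And>I. I \<in> S \<Longrightarrow> runs P (init_store (e I)) (poly p (val_size (e I))) (\<lambda>s. s 0 = enc_list ea (xs I))"
    by (rule polytimeE) blast
  from b0 obtain Q q where
    Q: "\<And>I. I \<in> S \<Longrightarrow> runs Q (init_store (e I)) (poly q (val_size (e I))) (\<lambda>s. s 0 = eb (b0 I))"
    by (rule polytimeE) blast
  from step obtain R r where
    R: "\<And>z. z \<in> T \<Longrightarrow> runs R (init_store (ext (ext e ea) eb z))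
      (poly r (val_size (ext (ext e ea) eb z))) (\<lambda>s. s 0 = eb (g (fst (fst z)) (snd (fst z)) (snd z)))"
    by (rule polytimeE) blast
  obtain N where N: "com_vars P \<subseteq> {..N}" "com_vars Q \<subseteq> {..N}" "com_vars R \<subseteq> {..N}"
    using com_vars_bound[of "{P, Q, R}"] by auto
  define a l c where "a = Suc N" and "l = Suc (Suc N)" and "c = Suc (Suc (Suc N))"
  have vars: "N < a" "N < l" "N < c" "a \<noteq> l" "a \<noteq> c" "l \<noteq> c" "a \<noteq> 0" "l \<noteq> 0" "c \<noteq> 0"
    by (auto simp: a_def l_def c_def)
  \<comment> \<open>The argument has the shape of \<open>ext (ext e ea) eb\<close>: context, current
    element, accumulator.\<close>
  define arg where "arg = MkPair (MkPair (Var a) (Left (Var l))) (Var c)"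
  define body where "body = Seq (call N R arg) (Seq (Assign c (Var 0)) (Assign l (Right (Var l))))"
  show ?thesis
  proof (rule polytimeI)
    fix I assume I: "I \<in> S"
    let ?E = "val_size (e I)" and ?X = "val_size (enc_list ea (xs I))"
    define st where "st j = fold (g I) (take j (xs I)) (b0 I)" for j
    \<comment> \<open>The 2 counts the two pair nodes of the step's argument. Building it costs at
      most \<open>?M\<close> for each of the two pairs, \<open>?M\<close> for the three components,
      and \<open>?X\<close> for reading the remaining list.\<close>
    let ?M = "?E + ?X + B I + 2"
    let ?A = "3 * ?M + ?X"
    let ?TR = "poly r ?M + ?A + 4 * N + 4"
    let ?TB = "1 + ?TR + (1 + (1 + B I) + (1 + 2 * ?X))"
    let ?C = "2 + ?X"
    let ?TW = "(?X + 1) * (1 + ?C + ?TB)"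
    \<comment> \<open>With \<open>k\<close> elements to go, the list register holds the last
      \<open>k\<close> elements and the accumulator is the fold over the others.\<close>
    define Inv where "Inv k s \<longleftrightarrow> k \<le> length (xs I) \<and> s a = e I \<and>
      s l = enc_list ea (drop (length (xs I) - k) (xs I)) \<and> s c = eb (st (length (xs I) - k))"
      for k and s :: store
    have st_size: "val_size (eb (st j)) \<le> B I" if "j \<le> length (xs I)" for j
      using B(2)[OF I that] by (simp add: st_def)
    have drop_size: "val_size (enc_list ea (drop j (xs I))) \<le> ?X" for j
    proof -
      have "?X = val_size (enc_list ea (take j (xs I) @ drop j (xs I)))" by simp
      then show ?thesis unfolding val_size_enc_list map_append sum_list_append length_append by simp
    qed
    have body: "runs body s ?TB (Inv k)" if "Inv (Suc k) s" for k s
    proof -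
      define j where "j = length (xs I) - Suc k"
      have j: "j < length (xs I)" "length (xs I) - k = Suc j" "k \<le> length (xs I)"
        using that by (auto simp: Inv_def j_def)
      have s: "s a = e I" "s l = enc_list ea (xs I ! j # drop (Suc j) (xs I))" "s c = eb (st j)"
        using that j(1) by (auto simp: Inv_def j_def[symmetric] Cons_nth_drop_Suc)
      have st: "st (Suc j) = g I (xs I ! j) (st j)"
        using j(1) by (simp add: st_def take_Suc_conv_app_nth)
      have arg: "eval_expr arg s = ext (ext e ea) eb ((I, xs I ! j), st j)"
        using s by (simp add: arg_def ext_def)
      have sz: "val_size (s l) \<le> ?X" "val_size (ea (xs I ! j)) \<le> ?X" "val_size (eb (st j)) \<le> B I"
        using drop_size[of j] st_size[of j] j(1) s elem_val_size[of "xs I ! j" "xs I" ea]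
        by (auto simp: Cons_nth_drop_Suc)
      have cost: "expr_cost arg s \<le> 3 * ?M + ?X"
        using sz s by (simp add: arg_def)
      have "val_size (eval_expr arg s) \<le> ?M"
        using sz unfolding arg by (simp add: ext_def)
      then have le: "poly r (val_size (eval_expr arg s)) \<le> poly r ?M"
        by (rule poly_nat_mono)
      have "runs R (init_store (eval_expr arg s)) (poly r (val_size (eval_expr arg s)))
          (\<lambda>s. s 0 = eb (st (Suc j)))"
        unfolding arg st using R[OF T[OF I j(1)]] unfolding st_def[symmetric] fst_conv snd_conv .
      from runs_weaken[OF this le]
      have "runs R (init_store (eval_expr arg s)) (poly r ?M) (\<lambda>s. s 0 = eb (st (Suc j)))" .
      then have 1: "runs (call N R arg) s ?TR
          (\<lambda>s'. s' 0 = eb (st (Suc j)) \<and> (\<forall>x>N. s' x = s x))"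
        by (rule runs_call[OF N(3) _ refl]) (use cost in simp)
      have 2: "runs (Assign c (Var 0)) s' (1 + B I) (\<lambda>s''. s'' a = e I \<and> s'' l = s l \<and> s'' c = eb (st (Suc j)))"
        if "s' 0 = eb (st (Suc j))" "\<forall>x>N. s' x = s x" for s'
        using that vars s st_size[of "Suc j"] j(1) by (intro runs_Assign) auto
      have 3: "runs (Assign l (Right (Var l))) s' (1 + 2 * ?X) (Inv k)"
        if "s' a = e I" "s' l = s l" "s' c = eb (st (Suc j))" for s'
      proof (rule runs_Assign)
        show "1 + expr_cost (Right (Var l)) s' \<le> 1 + 2 * ?X"
          using sz(1) val_size_right[of "s l"] that(2) by simp
        show "Inv k (s'(l := eval_expr (Right (Var l)) s'))"
          using that s(2) vars j(2,3) by (simp add: Inv_def)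
      qed
      show ?thesis unfolding body_def
        by (rule runs_Seq[OF 1 _ order_refl], rule runs_Seq[OF 2 _ order_refl]) (use 3 in auto)
    qed
    have 1: "runs (Assign a (Var 0)) (init_store (e I)) (1 + ?E) (\<lambda>s. s a = e I)"
      by (rule runs_Assign) (auto simp: init_store_def)
    have 2: "runs (call N P (Var a)) s (poly p ?E + ?E + 4 * N + 4)
        (\<lambda>s'. s' 0 = enc_list ea (xs I) \<and> (\<forall>x>N. s' x = s x))" if "s a = e I" for s
      using that by (intro runs_call[OF N(1) P[OF I]]) auto
    have 3: "runs (Assign l (Var 0)) s (1 + ?X) (\<lambda>s. s a = e I \<and> s l = enc_list ea (xs I))"
      if "s 0 = enc_list ea (xs I)" "s a = e I" for s
      using that vars by (intro runs_Assign) auto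
    have 4: "runs (call N Q (Var a)) s (poly q ?E + ?E + 4 * N + 4)
        (\<lambda>s'. s' 0 = eb (b0 I) \<and> (\<forall>x>N. s' x = s x))" if "s a = e I" for s
      using that by (intro runs_call[OF N(2) Q[OF I]]) auto
    have 5: "runs (Assign c (Var 0)) s (1 + B I) (Inv (length (xs I)))"
      if "s 0 = eb (b0 I)" "s a = e I" "s l = enc_list ea (xs I)" for s
      using that vars st_size[of 0] by (intro runs_Assign) (auto simp: Inv_def st_def)
    have 6: "runs (WHILE (IsPair (Var l)) body) s ?TW (Inv 0)" if "Inv (length (xs I)) s" for s
    proof -
      have cost: "expr_cost (IsPair (Var l)) s \<le> ?C" if "Inv k s" for s k
        using that drop_size[of "length (xs I) - k"] val_size_bool[of "is_pair (s l)"]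
        by (auto simp: Inv_def)
      have "runs (WHILE (IsPair (Var l)) body) s ((length (xs I) + 1) * (1 + ?C + ?TB)) (Inv 0)"
      proof (rule runs_WHILE[where Inv = Inv, OF that])
        fix k s assume k: "Inv (Suc k) s"
        \<comment> \<open>The empty list is coded as a number and any other as a pair, so
          \<open>IsPair\<close> tests for emptiness.\<close>
        then have "drop (length (xs I) - Suc k) (xs I) \<noteq> []" by (auto simp: Inv_def)
        with k have "holds (IsPair (Var l)) s"
          by (cases "drop (length (xs I) - Suc k) (xs I)") (auto simp: Inv_def holds_def val_of_bool_def)
        then show "holds (IsPair (Var l)) s \<and> expr_cost (IsPair (Var l)) s \<le> ?C \<and> runs body s ?TB (Inv k)"
          using body[OF k] cost[OF k] by blast
      next
        fix s assume k: "Inv 0 s"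
        then have "\<not> holds (IsPair (Var l)) s" by (auto simp: Inv_def holds_def val_of_bool_def)
        then show "\<not> holds (IsPair (Var l)) s \<and> expr_cost (IsPair (Var l)) s \<le> ?C"
          using cost[OF k] by blast
      qed
      \<comment> \<open>The number of iterations is replaced by the size of the list's code, which
        is known to be polynomial.\<close>
      moreover have "(length (xs I) + 1) * (1 + ?C + ?TB) \<le> ?TW"
        using length_le_val_size[of "xs I" ea] by (intro mult_right_mono) auto
      ultimately show ?thesis by (rule runs_weaken)
    qed
    have 7: "runs (Assign 0 (Var c)) s (1 + B I) (\<lambda>s. s 0 = eb (fold (g I) (xs I) (b0 I)))"
      if "Inv 0 s" for s
      using that st_size[of "length (xs I)"] by (intro runs_Assign) (auto simp: Inv_def st_def)
    have 67: "runs (Seq (WHILE (IsPair (Var l)) body) (Assign 0 (Var c))) s (1 + ?TW + (1 + B I))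
        (\<lambda>s. s 0 = eb (fold (g I) (xs I) (b0 I)))" if "Inv (length (xs I)) s" for s
      by (rule runs_Seq[OF 6[OF that] 7 order_refl])
    have 47: "runs (Seq (call N Q (Var a)) (Seq (Assign c (Var 0))
          (Seq (WHILE (IsPair (Var l)) body) (Assign 0 (Var c))))) s
        (1 + (poly q ?E + ?E + 4 * N + 4) + (1 + (1 + B I) + (1 + ?TW + (1 + B I))))
        (\<lambda>s. s 0 = eb (fold (g I) (xs I) (b0 I)))" if "s a = e I" "s l = enc_list ea (xs I)" for s
      by (rule runs_Seq[OF 4[of s, OF that(1)] _ order_refl], rule runs_Seq[OF 5 67 order_refl])
        (use that vars in auto)
    show "runs (Seq (Assign a (Var 0)) (Seq (call N P (Var a)) (Seq (Assign l (Var 0))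
        (Seq (call N Q (Var a)) (Seq (Assign c (Var 0))
          (Seq (WHILE (IsPair (Var l)) body) (Assign 0 (Var c))))))))
        (init_store (e I))
        (1 + (1 + ?E) + (1 + (poly p ?E + ?E + 4 * N + 4) + (1 + (1 + ?X) +
          (1 + (poly q ?E + ?E + 4 * N + 4) + (1 + (1 + B I) + (1 + ?TW + (1 + B I)))))))
        (\<lambda>s. s 0 = eb (fold (g I) (xs I) (b0 I)))"
      by (rule runs_Seq[OF 1 _ order_refl], rule runs_Seq[OF 2 _ order_refl], assumption,
          rule runs_Seq[OF 3 47 order_refl])
        (use vars in auto)
  qed (intro poly_bounded_intros polytime_size[OF xs] B(1))
qed

text \<open>Increments independent of the accumulator add up to at most their bound times the number
  of steps, and the size of the list's code bounds that number.\<close>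

lemma polytime_fold:
  fixes g :: "'i \<Rightarrow> 'a \<Rightarrow> 'b \<Rightarrow> 'b"
  assumes xs: "polytime S e (\<lambda>I. enc_list ea (xs I))"
    and init: "polytime S e (\<lambda>I. eb (init I))"
    and step: "polytime T (ext (ext e ea) eb) (\<lambda>z. eb (g (fst (fst z)) (snd (fst z)) (snd z)))"
    and T: "\<And>I j. I \<in> S \<Longrightarrow> j < length (xs I) \<Longrightarrow>
      ((I, xs I ! j), fold (g I) (take j (xs I)) (init I)) \<in> T"
    and G: "poly_bounded S (\<lambda>I. val_size (e I)) G"
      "\<And>I x b. ((I, x), b) \<in> T \<Longrightarrow> val_size (eb (g I x b)) \<le> val_size (eb b) + G I"
  shows "polytime S e (\<lambda>I. eb (fold (g I) (xs I) (init I)))"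
proof (rule polytime_fold_bounded[OF xs init step T])
  fix I j assume I: "I \<in> S" and "j \<le> length (xs I)"
  then have "val_size (eb (fold (g I) (take j (xs I)) (init I))) \<le> val_size (eb (init I)) + j * G I"
  proof (induction j)
    case (Suc j)
    then have j: "j < length (xs I)" by simp
    from G(2)[OF T[OF I j]] Suc j show ?case
      by (simp add: take_Suc_conv_app_nth)
  qed simp
  also have "\<dots> \<le> val_size (eb (init I)) + val_size (enc_list ea (xs I)) * G I"
    using \<open>j \<le> length (xs I)\<close> length_le_val_size[of "xs I" ea] by (simp add: mult_right_mono)
  finally show "val_size (eb (fold (g I) (take j (xs I)) (init I)))
    \<le> val_size (eb (init I)) + val_size (enc_list ea (xs I)) * G I" .
qed (intro poly_bounded_intros polytime_size[OF xs] polytime_size[OF init] G(1) | assumption)+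

section \<open>Arithmetic, Boolean operations and access to the context\<close>

lemma polytime_expr1:
  assumes "polytime S e f" "expr_vars E \<subseteq> {0}" "\<And>I. I \<in> S \<Longrightarrow> eval_expr E (init_store (f I)) = g I"
  shows "polytime S e g"
  using polytime_cong[OF polytime_expr[OF assms(1,2)] assms(3)] .

lemma polytime_left: "polytime S e f \<Longrightarrow> polytime S e (\<lambda>I. left_of (f I))"
  by (rule polytime_expr1[where E = "Left (Var 0)"]) (auto simp: init_store_def)

lemma polytime_right: "polytime S e f \<Longrightarrow> polytime S e (\<lambda>I. right_of (f I))"
  by (rule polytime_expr1[where E = "Right (Var 0)"]) (auto simp: init_store_def)

lemma polytime_is_pair: "polytime S e f \<Longrightarrow> polytime S e (\<lambda>I. val_of_bool (is_pair (f I)))"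
  by (rule polytime_expr1[where E = "IsPair (Var 0)"]) (auto simp: init_store_def)

lemma polytime_Num: "polytime S e (\<lambda>I. Num i)"
  by (rule polytime_expr1[OF polytime_self, where E = "Const i"]) auto

lemma polytime_const: "polytime S e (\<lambda>I. v)"
  by (induction v) (auto intro: polytime_Num polytime_Pair)

lemma polytime_expr2:
  assumes "polytime S e f" "polytime S e g" "expr_vars E \<subseteq> {0}"
    "\<And>I. I \<in> S \<Longrightarrow> eval_expr E (init_store (Pair (f I) (g I))) = h I"
  shows "polytime S e h"
  using polytime_expr1[OF polytime_Pair[OF assms(1,2)] assms(3,4)] .

lemma polytime_add:
  "polytime S e (\<lambda>I. Num (a I)) \<Longrightarrow> polytime S e (\<lambda>I. Num (b I)) \<Longrightarrow> polytime S e (\<lambda>I. Num (a I + b I))"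
  by (erule (1) polytime_expr2[where E = "Plus (Left (Var 0)) (Right (Var 0))"])
    (auto simp: init_store_def)

lemma polytime_diff:
  "polytime S e (\<lambda>I. Num (a I)) \<Longrightarrow> polytime S e (\<lambda>I. Num (b I)) \<Longrightarrow> polytime S e (\<lambda>I. Num (a I - b I))"
  by (erule (1) polytime_expr2[where E = "Minus (Left (Var 0)) (Right (Var 0))"])
    (auto simp: init_store_def)

lemma polytime_mult:
  "polytime S e (\<lambda>I. Num (a I)) \<Longrightarrow> polytime S e (\<lambda>I. Num (b I)) \<Longrightarrow> polytime S e (\<lambda>I. Num (a I * b I))"
  by (erule (1) polytime_expr2[where E = "Times (Left (Var 0)) (Right (Var 0))"])
    (auto simp: init_store_def)

lemma polytime_less:
  "polytime S e (\<lambda>I. Num (a I)) \<Longrightarrow> polytime S e (\<lambda>I. Num (b I)) \<Longrightarrow>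
    polytime S e (\<lambda>I. val_of_bool (a I < b I))"
  by (erule (1) polytime_expr2[where E = "Less (Left (Var 0)) (Right (Var 0))"])
    (auto simp: init_store_def)

lemma polytime_not:
  "polytime S e (\<lambda>I. val_of_bool (a I)) \<Longrightarrow> polytime S e (\<lambda>I. val_of_bool (\<not> a I))"
  by (rule polytime_expr1[where E = "Minus (Const 1) (Var 0)"])
    (auto simp: init_store_def val_of_bool_def)

lemma polytime_le:
  assumes "polytime S e (\<lambda>I. Num (a I))" "polytime S e (\<lambda>I. Num (b I))"
  shows "polytime S e (\<lambda>I. val_of_bool (a I \<le> b I))"
  using polytime_not[OF polytime_less[OF assms(2,1)]] by (simp add: not_less)

lemma polytime_conj:
  assumes "polytime S e (\<lambda>I. val_of_bool (a I))" "polytime S e (\<lambda>I. val_of_bool (b I))"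
  shows "polytime S e (\<lambda>I. val_of_bool (a I \<and> b I))"
  by (rule polytime_cong[OF polytime_If[OF assms polytime_const[of _ _ "val_of_bool False"]]]) auto

lemma polytime_disj:
  assumes "polytime S e (\<lambda>I. val_of_bool (a I))" "polytime S e (\<lambda>I. val_of_bool (b I))"
  shows "polytime S e (\<lambda>I. val_of_bool (a I \<or> b I))"
  by (rule polytime_cong[OF polytime_If[OF assms(1) polytime_const[of _ _ "val_of_bool True"] assms(2)]]) auto

text \<open>A function analyzed on one index set is reused at indices derived from another; this
  serves both for nested contexts and for calling the robust algorithm.\<close>

lemma polytime_lift:
  assumes "polytime S e f" "polytime S' e' (\<lambda>z. e (h z))" "\<And>z. z \<in> S' \<Longrightarrow> h z \<in> S"
  shows "polytime S' e' (\<lambda>z. f (h z))"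
  by (rule polytime_comp[OF assms(2,1,3)]) auto

lemma polytime_snd: "polytime S (ext e ea) (\<lambda>z. ea (snd z))"
  using polytime_right[OF polytime_self[of S "ext e ea"]] by (simp add: ext_def)

lemma polytime_ext:
  assumes "polytime S e f" "\<And>z. z \<in> S' \<Longrightarrow> fst z \<in> S"
  shows "polytime S' (ext e ea) (\<lambda>z. f (fst z))"
  using polytime_left[OF polytime_self[of S' "ext e ea"]]
  by (intro polytime_lift[OF assms(1)] assms(2)) (simp_all add: ext_def)

section \<open>List functions\<close>

lemma polytime_Cons:
  "polytime S e (\<lambda>I. ea (x I)) \<Longrightarrow> polytime S e (\<lambda>I. enc_list ea (xs I)) \<Longrightarrow>
    polytime S e (\<lambda>I. enc_list ea (x I # xs I))"
  by (simp add: polytime_Pair)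

lemma polytime_Nil: "polytime S e (\<lambda>I. enc_list ea [])"
  by (simp add: polytime_Num)

text \<open>Folding \<open>(#)\<close> yields the reversal, so reversal comes first and the later
  list functions use it to correct the order.\<close>

lemma polytime_rev:
  assumes "polytime S e (\<lambda>I. enc_list ea (xs I))"
  shows "polytime S e (\<lambda>I. enc_list ea (rev (xs I)))"
proof -
  have "polytime S e (\<lambda>I. enc_list ea (fold (#) (xs I) []))"
  proof (rule polytime_fold[where eb = "enc_list ea" and init = "\<lambda>_. []", OF assms polytime_Nil])
    let ?T = "{((I, x), b). x \<in> set (xs I)}"
    show "polytime ?T (ext (ext e ea) (enc_list ea)) (\<lambda>z. enc_list ea (snd (fst z) # snd z))"
      by (intro polytime_Cons polytime_snd polytime_ext[OF polytime_snd[of UNIV]]) auto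
    show "poly_bounded S (\<lambda>I. val_size (e I)) (\<lambda>I. 1 + val_size (enc_list ea (xs I)))"
      by (intro poly_bounded_intros polytime_size[OF assms])
  qed (auto simp: elem_val_size)
  then show ?thesis by (simp add: fold_Cons_rev)
qed

lemma polytime_map:
  fixes g :: "'i \<Rightarrow> 'a \<Rightarrow> 'b"
  assumes xs: "polytime S e (\<lambda>I. enc_list ea (xs I))"
    and g: "polytime (SIGMA I:S. set (xs I)) (ext e ea) (\<lambda>z. eb (g (fst z) (snd z)))"
  shows "polytime S e (\<lambda>I. enc_list eb (map (g I) (xs I)))"
proof -
  let ?T = "{((I, x), b). I \<in> S \<and> x \<in> set (xs I)}"
  \<comment> \<open>Each step adds one image to the accumulator. Its size is polynomial in that of
    the extended context, hence in the sizes of context and list, which gives the growth per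
    step.\<close>
  from polytime_size[OF g] obtain p where
    p: "\<And>I x. I \<in> S \<Longrightarrow> x \<in> set (xs I) \<Longrightarrow> val_size (eb (g I x)) \<le> poly p (val_size (ext e ea (I, x)))"
    unfolding poly_bounded_def by auto
  have "polytime S e (\<lambda>I. enc_list eb (fold (\<lambda>x. (#) (g I x)) (xs I) []))"
  proof (rule polytime_fold[where eb = "enc_list eb" and init = "\<lambda>_. []", OF xs polytime_Nil])
    show "polytime ?T (ext (ext e ea) (enc_list eb))
        (\<lambda>z. enc_list eb (g (fst (fst z)) (snd (fst z)) # snd z))"
      by (intro polytime_Cons polytime_snd polytime_ext[OF g]) auto
    show "poly_bounded S (\<lambda>I. val_size (e I))
        (\<lambda>I. 1 + poly p (1 + val_size (e I) + val_size (enc_list ea (xs I))))"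
      by (intro poly_bounded_intros polytime_size[OF xs])
    fix I x and b :: "'b list" assume "((I, x), b) \<in> ?T"
    then have I: "I \<in> S" "x \<in> set (xs I)" by auto
    then have "val_size (ext e ea (I, x)) \<le> 1 + val_size (e I) + val_size (enc_list ea (xs I))"
      using elem_val_size[OF I(2), of ea] by (simp add: ext_def)
    from p[OF I] poly_nat_mono[OF this, of p]
    show "val_size (enc_list eb (g I x # b))
      \<le> val_size (enc_list eb b) + (1 + poly p (1 + val_size (e I) + val_size (enc_list ea (xs I))))"
      by simp
  qed auto
  moreover have "fold (\<lambda>x. (#) (f x)) ys zs = rev (map f ys) @ zs" for f :: "'a \<Rightarrow> 'b" and ys zs
    by (induction ys arbitrary: zs) auto
  ultimately have "polytime S e (\<lambda>I. enc_list eb (rev (map (g I) (xs I))))" by simp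
  from polytime_rev[OF this] show ?thesis by simp
qed

lemma polytime_append:
  assumes xs: "polytime S e (\<lambda>I. enc_list ea (xs I))"
    and ys: "polytime S e (\<lambda>I. enc_list ea (ys I))"
  shows "polytime S e (\<lambda>I. enc_list ea (xs I @ ys I))"
proof -
  have "polytime S e (\<lambda>I. enc_list ea (fold (#) (rev (xs I)) (ys I)))"
  proof (rule polytime_fold[where eb = "enc_list ea", OF polytime_rev[OF xs] ys])
    let ?T = "{((I, x), b). x \<in> set (xs I)}"
    show "polytime ?T (ext (ext e ea) (enc_list ea)) (\<lambda>z. enc_list ea (snd (fst z) # snd z))"
      by (intro polytime_Cons polytime_snd polytime_ext[OF polytime_snd[of UNIV]]) auto
    show "poly_bounded S (\<lambda>I. val_size (e I)) (\<lambda>I. 1 + val_size (enc_list ea (xs I)))"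
      by (intro poly_bounded_intros polytime_size[OF xs])
    show "((I, rev (xs I) ! j), fold (#) (take j (rev (xs I))) (ys I)) \<in> ?T"
      if "j < length (rev (xs I))" for I j
      using nth_mem[OF that] by simp
  qed (auto simp: elem_val_size)
  then show ?thesis by (simp add: fold_Cons_rev)
qed

lemma polytime_concat:
  fixes xs :: "'i \<Rightarrow> 'a list list"
  assumes xs: "polytime S e (\<lambda>I. enc_list (enc_list ea) (xs I))"
  shows "polytime S e (\<lambda>I. enc_list ea (concat (xs I)))"
proof -
  have "polytime S e (\<lambda>I. enc_list ea (fold (\<lambda>x b. b @ x) (xs I) []))"
  proof (rule polytime_fold[where eb = "enc_list ea" and init = "\<lambda>_. []", OF xs polytime_Nil])
    let ?T = "{((I, x), b). x \<in> set (xs I)}"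
    show "polytime ?T (ext (ext e (enc_list ea)) (enc_list ea)) (\<lambda>z. enc_list ea (snd z @ snd (fst z)))"
      by (intro polytime_append polytime_snd polytime_ext[OF polytime_snd[of UNIV]]) auto
    show "poly_bounded S (\<lambda>I. val_size (e I)) (\<lambda>I. val_size (enc_list (enc_list ea) (xs I)))"
      by (intro poly_bounded_intros polytime_size[OF xs])
    fix I and x b :: "'a list" assume "((I, x), b) \<in> ?T"
    then have "val_size (enc_list ea x) \<le> val_size (enc_list (enc_list ea) (xs I))"
      by (auto intro: elem_val_size)
    then show "val_size (enc_list ea (b @ x)) \<le> val_size (enc_list ea b) + val_size (enc_list (enc_list ea) (xs I))"
      unfolding val_size_enc_list[of ea] by simp
  qed auto
  moreover have "fold (\<lambda>x b. b @ x) ys zs = zs @ concat ys" for ys :: "'a list list" and zs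
    by (induction ys arbitrary: zs) auto
  ultimately show ?thesis by simp
qed

text \<open>A filter is a concatenation of singleton and empty lists, which reduces it to the map
  and concatenation rules.\<close>

lemma polytime_filter:
  assumes xs: "polytime S e (\<lambda>I. enc_list ea (xs I))"
    and P: "polytime (SIGMA I:S. set (xs I)) (ext e ea) (\<lambda>z. val_of_bool (P (fst z) (snd z)))"
  shows "polytime S e (\<lambda>I. enc_list ea (filter (P I) (xs I)))"
proof -
  have "polytime S e (\<lambda>I. enc_list ea (concat (map (\<lambda>x. if P I x then [x] else []) (xs I))))"
    by (rule polytime_concat[OF polytime_map[OF xs]], subst if_distrib,
        rule polytime_If[OF P polytime_Cons[OF polytime_snd[of _ _ ea] polytime_Nil[of _ _ ea]] polytime_Nil])
  moreover have "concat (map (\<lambda>x. if P I x then [x] else []) ys) = filter (P I) ys" for I ys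
    by (induction ys) auto
  ultimately show ?thesis by simp
qed

lemma polytime_Bex:
  assumes xs: "polytime S e (\<lambda>I. enc_list ea (xs I))"
    and P: "polytime (SIGMA I:S. set (xs I)) (ext e ea) (\<lambda>z. val_of_bool (P (fst z) (snd z)))"
  shows "polytime S e (\<lambda>I. val_of_bool (\<exists>x\<in>set (xs I). P I x))"
proof (rule polytime_cong[OF polytime_is_pair[OF polytime_filter[OF assms]]])
  have "is_pair (enc_list ea ys) \<longleftrightarrow> ys \<noteq> []" for ys :: "'b list"
    by (cases ys) auto
  then show "val_of_bool (is_pair (enc_list ea (filter (P I) (xs I)))) = val_of_bool (\<exists>x\<in>set (xs I). P I x)" for I
    by (auto simp: filter_empty_conv)
qed

lemma polytime_tl:
  "polytime S e (\<lambda>I. enc_list ea (xs I)) \<Longrightarrow> polytime S e (\<lambda>I. enc_list ea (tl (xs I)))"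
proof (rule polytime_cong[OF polytime_right])
  show "right_of (enc_list ea (xs I)) = enc_list ea (tl (xs I))" for I by (cases "xs I") auto
qed

lemma polytime_hd:
  assumes "polytime S e (\<lambda>I. enc_list ea (xs I))" "\<And>I. I \<in> S \<Longrightarrow> xs I \<noteq> []"
  shows "polytime S e (\<lambda>I. ea (hd (xs I)))"
proof (rule polytime_cong[OF polytime_left[OF assms(1)]])
  show "left_of (enc_list ea (xs I)) = ea (hd (xs I))" if "I \<in> S" for I
    using assms(2)[OF that] by (cases "xs I") auto
qed

lemma polytime_last:
  assumes "polytime S e (\<lambda>I. enc_list ea (xs I))" "\<And>I. I \<in> S \<Longrightarrow> xs I \<noteq> []"
  shows "polytime S e (\<lambda>I. ea (last (xs I)))"
  using polytime_hd[OF polytime_rev[OF assms(1)]] assms(2) by (simp add: hd_rev)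

lemma polytime_butlast:
  assumes "polytime S e (\<lambda>I. enc_list ea (xs I))"
  shows "polytime S e (\<lambda>I. enc_list ea (butlast (xs I)))"
  using polytime_rev[OF polytime_tl[OF polytime_rev[OF assms]]] by (simp flip: butlast_rev)

lemma polytime_sum_list:
  assumes xs: "polytime S e (\<lambda>I. enc_list enc_nat (xs I))"
  shows "polytime S e (\<lambda>I. enc_nat (sum_list (xs I)))"
proof -
  have "polytime S e (\<lambda>I. enc_nat (fold (+) (xs I) 0))"
  proof (rule polytime_fold[where eb = enc_nat and init = "\<lambda>_. 0" and g = "\<lambda>_. (+)", OF xs])
    let ?T = "{((I, x), b). x \<in> set (xs I)}"
    show "polytime ?T (ext (ext e enc_nat) enc_nat) (\<lambda>z. enc_nat (snd (fst z) + snd z))"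
      unfolding enc_nat_def of_nat_add
      by (intro polytime_add polytime_snd[where ea = "\<lambda>n. Num (int n)"]
          polytime_ext[OF polytime_snd[of UNIV, where ea = "\<lambda>n. Num (int n)"]]) auto
    show "poly_bounded S (\<lambda>I. val_size (e I)) (\<lambda>I. val_size (enc_list enc_nat (xs I)))"
      by (intro poly_bounded_intros polytime_size[OF xs])
    fix I and x b :: nat assume "((I, x), b) \<in> ?T"
    then have "val_size (enc_nat x) \<le> val_size (enc_list enc_nat (xs I))"
      by (auto intro: elem_val_size)
    then show "val_size (enc_nat (x + b)) \<le> val_size (enc_nat b) + val_size (enc_list enc_nat (xs I))"
      using val_size_add[of "int x" "int b"] by (simp add: enc_nat_def)
  qed (auto simp: enc_nat_def polytime_Num)
  then show ?thesis by (simp add: fold_plus_sum_list_rev)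
qed

text \<open>A linear bound is enough for counters that never exceed the length of a list at
  hand.\<close>

lemma val_size_of_nat: "val_size (Num (int n)) \<le> Suc n"
proof -
  have "int n < 2 ^ n" by (metis of_nat_less_two_power)
  then have "nat (bitlen \<bar>int n\<bar>) \<le> n" unfolding bitlen_abs_le by simp
  then show ?thesis by simp
qed

text \<open>An interval is built along a list of the right length and not from its upper bound: a
  number in binary is exponentially shorter than the interval below it.\<close>

lemma polytime_upt_length:
  assumes xs: "polytime S e (\<lambda>I. enc_list ea (xs I))"
  shows "polytime S e (\<lambda>I. enc_list enc_nat [0..<length (xs I)])"
    and "polytime S e (\<lambda>I. enc_nat (length (xs I)))"
proof -
  define eb where "eb = (\<lambda>(c, l). Pair (enc_nat c) (enc_list enc_nat l))"
  \<comment> \<open>The elements are ignored. The accumulator pairs a counter with its earlier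
    values, the newest first.\<close>
  define g where "g = (\<lambda>(_ :: 'b) (c :: nat, l). (c + 1, c # l))"
  have fold_g: "fold g ys (0, []) = (length ys, rev [0..<length ys])" for ys
    by (induction ys rule: rev_induct) (auto simp: g_def)
  have "polytime S e (\<lambda>I. eb (fold g (xs I) (0, [])))"
  proof (rule polytime_fold[where eb = eb and init = "\<lambda>_. (0, [])" and g = "\<lambda>_. g", OF xs])
    let ?T = "{((I, x), (c, l)). c \<le> length (xs I)}"
    have c: "polytime ?T (ext (ext e ea) eb) (\<lambda>z. enc_nat (fst (snd z)))"
      by (rule polytime_cong[OF polytime_left[OF polytime_snd]]) (auto simp: eb_def)
    have l: "polytime ?T (ext (ext e ea) eb) (\<lambda>z. enc_list enc_nat (snd (snd z)))"
      by (rule polytime_cong[OF polytime_right[OF polytime_snd]]) (auto simp: eb_def)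
    have "polytime ?T (ext (ext e ea) eb)
      (\<lambda>z. Pair (enc_nat (fst (snd z) + 1)) (enc_list enc_nat (fst (snd z) # snd (snd z))))"
      using polytime_add[OF c[unfolded enc_nat_def] polytime_Num[of _ _ 1]]
      by (intro polytime_Pair polytime_Cons c l) (simp add: enc_nat_def add.commute)
    then show "polytime ?T (ext (ext e ea) eb) (\<lambda>z. eb (g (snd (fst z)) (snd z)))"
      by (simp add: eb_def g_def case_prod_unfold)
    show "polytime S e (\<lambda>I. eb (0, []))"
      by (rule polytime_const)
    show "poly_bounded S (\<lambda>I. val_size (e I)) (\<lambda>I. 4 + val_size (enc_list ea (xs I)))"
      by (intro poly_bounded_intros polytime_size[OF xs])
    show "((I, xs I ! j), fold g (take j (xs I)) (0, [])) \<in> ?T" for I j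
      by (auto simp: fold_g)
    show "val_size (eb (g x b)) \<le> val_size (eb b) + (4 + val_size (enc_list ea (xs I)))"
      if "((I, x), b) \<in> ?T" for I x b
      using that val_size_add[of "int (fst b)" 1] val_size_of_nat[of "fst b"] length_le_val_size[of "xs I" ea]
      by (auto simp: eb_def g_def enc_nat_def bitlen_alt_def[of 1] add.commute split: prod.splits)
  qed
  note p = this[unfolded fold_g, unfolded eb_def, simplified]
  show "polytime S e (\<lambda>I. enc_list enc_nat [0..<length (xs I)])"
    using polytime_rev[OF polytime_right[OF p, simplified]] by simp
  show "polytime S e (\<lambda>I. enc_nat (length (xs I)))"
    using polytime_left[OF p] by simp
qed

lemma polytime_nth:
  assumes xs: "polytime S e (\<lambda>I. enc_list ea (xs I))"
    and i: "polytime S e (\<lambda>I. enc_nat (i I))" "\<And>I. I \<in> S \<Longrightarrow> i I < length (xs I)"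
  shows "polytime S e (\<lambda>I. ea (xs I ! i I))"
proof -
  define eb where "eb = (\<lambda>(c, v). Pair (Num c) v)"
  \<comment> \<open>A fold cannot stop early. The counter runs down from the index, the element met
    at 0 is stored, and from then on the counter is negative and the stored value is kept.\<close>
  define g where "g = (\<lambda>(x :: 'b) (c :: int, v). (c - 1, if c = 0 then ea x else v))"
  have g: "g y (0, v) = (-1, ea y)" "c \<noteq> 0 \<Longrightarrow> g y (c, v) = (c - 1, v)" for y v c
    by (simp_all add: g_def)
  have fold_g_neg: "c < 0 \<Longrightarrow> snd (fold g ys (c, v)) = v" for ys v c
    by (induction ys arbitrary: c) (simp_all add: g(2))
  have fold_g: "k < length ys \<Longrightarrow> snd (fold g ys (int k, v)) = ea (ys ! k)" for ys k v
  proof (induction ys arbitrary: k)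
    case (Cons y ys)
    then show ?case by (cases k) (simp_all add: g fold_g_neg)
  qed simp
  have "polytime S e (\<lambda>I. eb (fold g (xs I) (int (i I), Num 0)))"
  proof (rule polytime_fold[where eb = eb and init = "\<lambda>I. (int (i I), Num 0)" and g = "\<lambda>_. g", OF xs])
    let ?T = "{((I, x), b). x \<in> set (xs I)}"
    have c: "polytime ?T (ext (ext e ea) eb) (\<lambda>z. Num (fst (snd z)))"
      by (rule polytime_cong[OF polytime_left[OF polytime_snd]]) (auto simp: eb_def)
    have l: "polytime ?T (ext (ext e ea) eb) (\<lambda>z. snd (snd z))"
      by (rule polytime_cong[OF polytime_right[OF polytime_snd]]) (auto simp: eb_def)
    have x: "polytime ?T (ext (ext e ea) eb) (\<lambda>z. ea (snd (fst z)))"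
      by (rule polytime_ext[OF polytime_snd[of UNIV]]) auto
    have z: "polytime ?T (ext (ext e ea) eb) (\<lambda>z. val_of_bool (fst (snd z) = 0))"
      using polytime_conj[OF polytime_le[OF c polytime_Num[of _ _ 0]] polytime_le[OF polytime_Num[of _ _ 0] c]]
      by (simp add: order_eq_iff[symmetric])
    have "polytime ?T (ext (ext e ea) eb)
      (\<lambda>z. Pair (Num (fst (snd z) - 1)) (if fst (snd z) = 0 then ea (snd (fst z)) else snd (snd z)))"
      by (intro polytime_Pair polytime_If z x l polytime_diff c polytime_Num)
    then show "polytime ?T (ext (ext e ea) eb) (\<lambda>z. eb (g (snd (fst z)) (snd z)))"
      by (simp add: eb_def g_def case_prod_unfold)
    show "polytime S e (\<lambda>I. eb (int (i I), Num 0))"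
      using i(1) by (auto simp: eb_def enc_nat_def intro: polytime_Pair polytime_Num)
    show "poly_bounded S (\<lambda>I. val_size (e I)) (\<lambda>I. 4 + val_size (enc_list ea (xs I)))"
      by (intro poly_bounded_intros polytime_size[OF xs])
    show "val_size (eb (g x b)) \<le> val_size (eb b) + (4 + val_size (enc_list ea (xs I)))"
      if "((I, x), b) \<in> ?T" for I x b
      using that val_size_diff[of "fst b" 1] elem_val_size[of x "xs I" ea]
      by (auto simp: eb_def g_def enc_nat_def bitlen_alt_def[of 1] add.commute split: prod.splits)
  qed auto
  from polytime_right[OF this] show ?thesis
    by (rule polytime_cong) (simp add: eb_def fold_g i(2) case_prod_unfold)
qed

section \<open>The reduction\<close>

lemma in_covered_iff:
  assumes "Metric_space X d"
  shows "u \<in> covered X d r C \<beta> \<longleftrightarrow>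
    u \<in> X \<and> (\<exists>i<length r. \<exists>c\<in>C ! i. c \<in> X \<and> d c u \<le> \<beta> * r ! i)"
  by (auto simp: covered_def Metric_space.in_mcball[OF assms])

section \<open>Greedy separated nets\<close>

definition greedy :: "('a \<Rightarrow> 'a \<Rightarrow> bool) \<Rightarrow> 'a list \<Rightarrow> 'a list" where
  "greedy R xs = fold (\<lambda>x ys. if \<exists>y\<in>set ys. R x y then ys else x # ys) xs []"

lemma greedy_Nil: "greedy R [] = []"
  by (simp add: greedy_def)

lemma greedy_snoc:
  "greedy R (xs @ [x]) = (if \<exists>y\<in>set (greedy R xs). R x y then greedy R xs else x # greedy R xs)"
  by (simp add: greedy_def)

lemma set_greedy: "set (greedy R xs) \<subseteq> set xs"
  by (induction xs rule: rev_induct) (auto simp: greedy_snoc greedy_Nil)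

text \<open>By reflexivity an element already accepted blocks its own repetition.\<close>

lemma distinct_greedy: "(\<And>x. x \<in> set xs \<Longrightarrow> R x x) \<Longrightarrow> distinct (greedy R xs)"
  by (induction xs rule: rev_induct) (auto simp: greedy_snoc greedy_Nil)

text \<open>An element is compared only with those accepted before it; symmetry supplies the
  opposite order.\<close>

lemma greedy_separated:
  assumes "\<And>x y. R x y \<Longrightarrow> R y x"
  shows "x \<in> set (greedy R xs) \<Longrightarrow> y \<in> set (greedy R xs) \<Longrightarrow> x \<noteq> y \<Longrightarrow> \<not> R x y"
proof (induction xs arbitrary: x y rule: rev_induct)
  case Nil
  then show ?case by (simp add: greedy_Nil)
next
  case (snoc z xs)
  show ?case
  proof (cases "\<exists>y\<in>set (greedy R xs). R z y")
    case True
    with snoc show ?thesis by (simp add: greedy_snoc)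
  next
    case False
    with snoc.prems snoc.IH[of x y] assms[of x y] show ?thesis
      unfolding greedy_snoc by (cases "x = z"; cases "y = z") auto
  qed
qed

text \<open>A rejected element is related to an accepted one, an accepted element to itself, and
  nothing is ever removed.\<close>

lemma greedy_covers:
  assumes "\<And>x. x \<in> set xs \<Longrightarrow> R x x"
  shows "x \<in> set xs \<Longrightarrow> \<exists>y\<in>set (greedy R xs). R x y"
  using assms
proof (induction xs rule: rev_induct)
  case (snoc z xs)
  show ?case
  proof (cases "x = z")
    case True
    with snoc.prems(2)[of z] show ?thesis by (auto simp: greedy_snoc)
  next
    case False
    with snoc.prems have "\<exists>y\<in>set (greedy R xs). R x y" by (intro snoc.IH) auto
    then show ?thesis by (auto simp: greedy_snoc)
  qed
qed simp

section \<open>Passing to the net and back in an abstract metric space\<close>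

lemma Metric_space_nth:
  assumes "Metric_space X d" "distinct ps" "set ps \<subseteq> X"
  shows "Metric_space {..<length ps} (\<lambda>x y. d (ps ! x) (ps ! y))"
proof -
  interpret Metric_space X d by fact
  have X: "ps ! x \<in> X" if "x < length ps" for x
    using assms(3) that by (auto dest: nth_mem)
  \<comment> \<open>Inputs number their points consecutively, so the subspace is presented on
    indices. Distinctness of \<open>ps\<close> ensures that distance 0 still means equality.\<close>
  show ?thesis
    by unfold_locales
      (use X assms(2) in \<open>auto simp: commute nth_eq_iff_index_eq intro: triangle\<close>)
qed

text \<open>
  A ball of the optimal solution contains at most one point of \<open>ps\<close> if it has the smallest radius,
  and moves its center to a point of \<open>ps\<close> at the price of doubling its radius otherwise.
\<close>

lemma feasible_reduced:
  fixes X :: "'a set" and ps :: "'a list"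
  assumes met: "Metric_space X d" and fin: "finite X"
    and len: "length r = Suc s" "length k = Suc s"
    and sol: "nukc_solution X d r k C \<gamma>"
    and ps: "distinct ps" "set ps \<subseteq> X"
    and sep: "\<And>x y. x \<in> set ps \<Longrightarrow> y \<in> set ps \<Longrightarrow> x \<noteq> y \<Longrightarrow> 2 * \<gamma> * last r < d x y"
  shows "\<exists>C'. robust_solution {..<length ps} (\<lambda>x y. d (ps ! x) (ps ! y)) (butlast r) (butlast k)
    (int (length ps) - int (last k)) C' (2 * \<gamma>)"
proof -
  interpret Metric_space X d by (rule met)
  let ?n = "length ps" and ?d = "\<lambda>x y. d (ps ! x) (ps ! y)"
  note met' = Metric_space_nth[OF met ps]
  have last: "last r = r ! s" "last k = k ! s"
    using len by (simp_all add: last_conv_nth flip: length_0_conv)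
  have adm: "C ! i \<subseteq> X" "card (C ! i) \<le> k ! i" "finite (C ! i)" if "i < Suc s" for i
    using sol len that finite_subset[OF _ fin]
    unfolding nukc_solution_def admissible_centers_def by auto
  have psX: "ps ! x \<in> X" if "x < ?n" for x using ps(2) that by (auto dest: nth_mem)
  \<comment> \<open>Only balls that meet \<open>ps\<close> can be recentered, and only they matter
    for covering \<open>ps\<close>. The new center is given by its index \<open>f i c\<close> in
    \<open>ps\<close>.\<close>
  define D where "D i = {c \<in> C ! i. \<exists>x<?n. d c (ps ! x) \<le> \<gamma> * r ! i}" for i
  define f where "f i c = (SOME x. x < ?n \<and> d c (ps ! x) \<le> \<gamma> * r ! i)" for i c
  have f: "f i c < ?n \<and> d c (ps ! f i c) \<le> \<gamma> * r ! i" if "c \<in> D i" for i c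
    using that someI_ex[of "\<lambda>x. x < ?n \<and> d c (ps ! x) \<le> \<gamma> * r ! i"] unfolding D_def f_def by blast
  define C' where "C' = map (\<lambda>i. f i ` D i) [0..<s]"
  let ?cov = "covered {..<?n} ?d (butlast r) C' (2 * \<gamma>)"
  have adm': "admissible_centers {..<?n} (butlast k) C'"
    unfolding admissible_centers_def
  proof (intro conjI allI impI)
    show "length C' = length (butlast k)" using len by (simp add: C'_def)
    fix i assume "i < length (butlast k)"
    then have i: "i < s" using len by simp
    have "D i \<subseteq> C ! i" by (auto simp: D_def)
    then have "card (f i ` D i) \<le> card (C ! i)"
      using adm(3)[of i] i by (meson card_image_le card_mono finite_subset le_trans less_SucI)
    then show "C' ! i \<subseteq> {..<?n}" "card (C' ! i) \<le> butlast k ! i"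
      using i adm(2)[of i] len f by (auto simp: C'_def nth_butlast)
  qed
  define B where "B = {..<?n} - ?cov"
  \<comment> \<open>A larger ball containing the point would contain its own new center as well; the
    doubled ball around that center would reach the point. So a point left over lies in one of the
    smallest balls.\<close>
  have "\<exists>c\<in>C ! s. d c (ps ! x) \<le> \<gamma> * r ! s" if x: "x \<in> B" for x
  proof -
    have xn: "x < ?n" "x \<notin> ?cov" using x by (auto simp: B_def)
    with sol psX obtain i c where c: "i < Suc s" "c \<in> C ! i" "c \<in> X" "d c (ps ! x) \<le> \<gamma> * r ! i"
      unfolding nukc_solution_def using len by (force simp: in_covered_iff[OF met])
    have False if i: "i < s"
    proof -
      have cD: "c \<in> D i" using c xn(1) by (auto simp: D_def)
      have "d (ps ! f i c) (ps ! x) \<le> d c (ps ! f i c) + d c (ps ! x)"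
        using f[OF cD] c(3) psX xn(1) by (intro triangle'') auto
      also have "\<dots> \<le> 2 * \<gamma> * r ! i" using f[OF cD] c(4) by simp
      finally have "x \<in> ?cov"
        using i len xn(1) cD f[OF cD]
        by (auto simp: in_covered_iff[OF met'] C'_def nth_butlast intro!: exI[of _ i])
      with xn(2) show False ..
    qed
    then have "i = s" using c(1) by (auto simp: less_Suc_eq)
    with c show ?thesis by blast
  qed
  then obtain g where g: "\<And>x. x \<in> B \<Longrightarrow> g x \<in> C ! s \<and> d (g x) (ps ! x) \<le> \<gamma> * r ! s"
    by metis
  \<comment> \<open>Two points of one closed ball may be exactly twice its radius apart, which is
    why the separation is strict.\<close>
  have "inj_on g B"
  proof (rule inj_onI, rule ccontr)
    fix x y assume xy: "x \<in> B" "y \<in> B" "g x = g y" "x \<noteq> y"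
    then have n: "x < ?n" "y < ?n" by (auto simp: B_def)
    then have "ps ! x \<noteq> ps ! y" using ps(1) xy(4) by (simp add: nth_eq_iff_index_eq)
    then have "2 * \<gamma> * r ! s < d (ps ! x) (ps ! y)" using sep[of "ps ! x" "ps ! y"] n last by simp
    also have "\<dots> \<le> d (g x) (ps ! x) + d (g x) (ps ! y)"
      using g[OF xy(1)] adm(1)[of s] psX n by (intro triangle'') auto
    also have "\<dots> \<le> 2 * \<gamma> * r ! s" using g[OF xy(1)] g[OF xy(2)] xy(3) by simp
    finally show False by simp
  qed
  then have "card B \<le> card (C ! s)"
    using g adm(3)[of s] by (intro card_inj_on_le[of g]) auto
  then have "card B \<le> last k" using adm(2)[of s] last by simp
  moreover have "?cov \<subseteq> {..<?n}" by (auto simp: in_covered_iff[OF met'])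
  then have "card B = ?n - card ?cov" "card ?cov \<le> ?n"
    unfolding B_def using card_mono[of "{..<?n}" ?cov] by (simp_all add: card_Diff_subset finite_subset)
  ultimately have "int ?n - int (last k) \<le> int (card ?cov)" by linarith
  with adm' sol show ?thesis unfolding robust_solution_def nukc_solution_def by auto
qed

text \<open>The net leaves an additive error \<open>2 * \<gamma> * last r\<close>, whereas a
  dilation factor acts multiplicatively. As the last radius is the smallest, the error is at most
  \<open>2 * \<gamma> * r ! i\<close> for every ball, so it can be absorbed by adding
  \<open>2 * \<gamma>\<close> to the factor; the ordering of the radii enters here.\<close>

lemma extend_solution:
  fixes X :: "'a set" and ps :: "'a list"
  assumes met: "Metric_space X d"
    and len: "length r = Suc s" "length k = Suc s"
    and r: "sorted_wrt (\<ge>) r" "\<And>x. x \<in> set r \<Longrightarrow> 0 \<le> x"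
    and ps: "distinct ps" "set ps \<subseteq> X"
    and net: "\<And>x. x \<in> X \<Longrightarrow> \<exists>y\<in>set ps. d x y \<le> 2 * \<gamma> * last r"
    and sol: "robust_solution {..<length ps} (\<lambda>x y. d (ps ! x) (ps ! y)) (butlast r) (butlast k)
      (int (length ps) - int (last k)) C \<beta>"
    and \<gamma>: "0 \<le> \<gamma>"
    and M: "M = {p \<in> set ps. \<not> (\<exists>i<s. \<exists>c\<in>(!) ps ` (C ! i). d c p \<le> \<beta> * r ! i)}"
  shows "nukc_solution X d r k (map ((`) ((!) ps)) C @ [M]) (\<beta> + 2 * \<gamma>)"
proof -
  interpret Metric_space X d by (rule met)
  let ?n = "length ps" and ?d = "\<lambda>x y. d (ps ! x) (ps ! y)" and ?C = "map ((`) ((!) ps)) C @ [M]"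
  let ?cov = "covered {..<?n} ?d (butlast r) C \<beta>"
  note met' = Metric_space_nth[OF met ps]
  have last: "last r = r ! s" "last k = k ! s"
    using len by (simp_all add: last_conv_nth flip: length_0_conv)
  have psX: "ps ! x \<in> X" if "x < ?n" for x using ps(2) that by (auto dest: nth_mem)
  have lenC: "length C = s" and \<beta>: "0 \<le> \<beta>" and cov: "int ?n - int (last k) \<le> int (card ?cov)"
    using sol len by (auto simp: robust_solution_def admissible_centers_def)
  have adm: "C ! i \<subseteq> {..<?n}" "card (C ! i) \<le> k ! i" if "i < s" for i
    using sol len that by (auto simp: robust_solution_def admissible_centers_def nth_butlast)
  have cov_sub: "?cov \<subseteq> {..<?n}" by (auto simp: in_covered_iff[OF met'])
  have "M \<subseteq> (!) ps ` ({..<?n} - ?cov)"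
  proof
    fix p assume p: "p \<in> M"
    then obtain x where x: "x < ?n" "p = ps ! x" by (auto simp: M in_set_conv_nth)
    have "x \<notin> ?cov"
      using p x len by (fastforce simp: M in_covered_iff[OF met'] nth_butlast)
    with x show "p \<in> (!) ps ` ({..<?n} - ?cov)" by blast
  qed
  then have "card M \<le> card ({..<?n} - ?cov)"
    by (meson card_image_le card_mono finite_Diff finite_imageI finite_lessThan le_trans)
  also have "\<dots> = ?n - card ?cov"
    using cov_sub by (simp add: card_Diff_subset finite_subset)
  \<comment> \<open>The target is an integer and may be negative, namely when the last budget
    exceeds the size of the net; the inequality then holds trivially.\<close>
  finally have cardM: "card M \<le> k ! s" using cov last by linarith
  have "admissible_centers X k ?C"
    unfolding admissible_centers_def
  proof (intro conjI allI impI)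
    show "length ?C = length k" using lenC len by simp
    fix i assume "i < length k"
    then consider "i < s" | "i = s" using len by (auto simp: less_Suc_eq)
    then have "?C ! i \<subseteq> X \<and> card (?C ! i) \<le> k ! i"
    proof cases
      case 1
      have "card ((!) ps ` (C ! i)) \<le> card (C ! i)"
        using adm(1)[OF 1] by (intro card_image_le) (auto intro: finite_subset)
      then show ?thesis
        using 1 adm[OF 1] lenC psX by (auto simp: nth_append)
    next
      case 2
      then show ?thesis
        using lenC cardM ps(2) by (auto simp: nth_append M)
    qed
    then show "?C ! i \<subseteq> X" "card (?C ! i) \<le> k ! i" by auto
  qed
  moreover have "X \<subseteq> covered X d r ?C (\<beta> + 2 * \<gamma>)"
  proof
    fix u assume u: "u \<in> X"
    from net[OF u] obtain y where y: "y \<in> set ps" "d u y \<le> 2 * \<gamma> * r ! s" using last by auto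
    have yX: "y \<in> X" using y ps(2) by blast
    show "u \<in> covered X d r ?C (\<beta> + 2 * \<gamma>)"
    proof (cases "y \<in> M")
      case True
      have "0 \<le> r ! s" using r(2)[of "r ! s"] len by simp
      then have "2 * \<gamma> * r ! s \<le> (\<beta> + 2 * \<gamma>) * r ! s" using \<beta> by (intro mult_right_mono) auto
      with y(2) have "d y u \<le> (\<beta> + 2 * \<gamma>) * r ! s" by (simp add: commute)
      with True u yX len lenC show ?thesis
        by (auto simp: in_covered_iff[OF met] nth_append intro!: exI[of _ s])
    next
      case False
      with y(1) obtain i x where x: "i < s" "x \<in> C ! i" "d (ps ! x) y \<le> \<beta> * r ! i"
        by (auto simp: M)
      have "r ! s \<le> r ! i" using r(1) x(1) len by (simp add: sorted_wrt_iff_nth_less)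
      then have "2 * \<gamma> * r ! s \<le> 2 * \<gamma> * r ! i" using \<gamma> by (intro mult_left_mono) auto
      moreover have "d (ps ! x) u \<le> d (ps ! x) y + d u y"
        using x adm(1)[OF x(1)] psX u yX by (intro triangle') auto
      ultimately have "d (ps ! x) u \<le> (\<beta> + 2 * \<gamma>) * r ! i"
        using x(3) y(2) by (simp add: algebra_simps)
      moreover have "ps ! x \<in> ?C ! i" "ps ! x \<in> X"
        using x adm(1)[OF x(1)] lenC psX by (auto simp: nth_append)
      ultimately show ?thesis
        using u x(1) len by (auto simp: in_covered_iff[OF met] intro!: exI[of _ i])
    qed
  qed
  ultimately show ?thesis using \<beta> \<gamma> by (simp add: nukc_solution_def)
qed

text \<open>Only finitely many dilation factors matter, namely those at which some ball gains a point.\<close>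

lemma feasible_candidate:
  assumes met: "Metric_space X d"
    and r: "\<And>x. x \<in> set r \<Longrightarrow> 0 \<le> x"
    and sol: "nukc_solution X d r k C \<beta>"
    and F: "finite F" "0 \<in> F" "\<And>x y i. x \<in> X \<Longrightarrow> y \<in> X \<Longrightarrow> i < length r \<Longrightarrow> 0 < r ! i \<Longrightarrow> d x y / r ! i \<in> F"
  shows "\<exists>\<gamma>\<in>F. \<gamma> \<le> \<beta> \<and> nukc_solution X d r k C \<gamma>"
proof -
  interpret Metric_space X d by (rule met)
  have \<beta>: "0 \<le> \<beta>" using sol by (simp add: nukc_solution_def)
  define G where "G = {\<gamma>\<in>F. \<gamma> \<le> \<beta>}"
  have G: "finite G" "0 \<in> G" using F \<beta> by (auto simp: G_def)
  \<comment> \<open>Rounding \<beta> down to a candidate loses no point: a point covered at \<beta>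
    by a ball of positive radius yields a candidate that is at most \<beta>, hence at most
    \<gamma>.\<close>
  define \<gamma> where "\<gamma> = Max G"
  have \<gamma>: "\<gamma> \<in> G" "0 \<le> \<gamma>" "\<And>x. x \<in> G \<Longrightarrow> x \<le> \<gamma>"
    using Max_in[OF G(1)] Max_ge[OF G(1)] G(2) unfolding \<gamma>_def by auto
  have "X \<subseteq> covered X d r C \<gamma>"
  proof
    fix u assume u: "u \<in> X"
    with sol have "u \<in> covered X d r C \<beta>" unfolding nukc_solution_def by blast
    then obtain i c where c: "i < length r" "c \<in> C ! i" "c \<in> X" "d c u \<le> \<beta> * r ! i"
      unfolding in_covered_iff[OF met] by blast
    have "d c u \<le> \<gamma> * r ! i"
    proof (cases "0 < r ! i")
      case True
      then have "d c u / r ! i \<in> G" using F(3)[OF c(3) u c(1)] c(4) by (simp add: G_def divide_simps)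
      then have "d c u / r ! i \<le> \<gamma>" by (rule \<gamma>(3))
      then show ?thesis using True by (simp add: divide_simps)
    next
      \<comment> \<open>A ball of radius 0 does not change with the dilation factor.\<close>
      case False
      with r[OF nth_mem[OF c(1)]] have "r ! i = 0" by linarith
      with c(4) show ?thesis by simp
    qed
    with u c show "u \<in> covered X d r C \<gamma>" by (auto simp: in_covered_iff[OF met])
  qed
  then show ?thesis using sol \<gamma> by (intro bexI[of _ \<gamma>]) (auto simp: nukc_solution_def G_def)
qed

section \<open>Solvability of robust instances\<close>

lemma card_covered_le:
  assumes met: "Metric_space X d" and fin: "finite X" and adm: "admissible_centers X k C"
    and len: "length r = length k"
    and small: "\<And>i c u. i < length k \<Longrightarrow> c \<in> C ! i \<Longrightarrow> u \<in> X \<Longrightarrow> d c u \<le> \<beta> * r ! i \<Longrightarrow> u = c"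
  shows "card (covered X d r C \<beta>) \<le> sum_list k"
proof -
  have "covered X d r C \<beta> \<subseteq> (\<Union>i<length k. C ! i)"
    using small unfolding in_covered_iff[OF met] len subset_iff by blast
  moreover have "finite (\<Union>i<length k. C ! i)"
    using adm fin unfolding admissible_centers_def by (auto intro: finite_subset)
  ultimately have "card (covered X d r C \<beta>) \<le> card (\<Union>i<length k. C ! i)"
    by (rule card_mono[rotated])
  also have "\<dots> \<le> (\<Sum>i<length k. card (C ! i))"
    by (rule card_UN_le) simp
  also have "\<dots> \<le> (\<Sum>i<length k. k ! i)"
    using adm by (intro sum_mono) (auto simp: admissible_centers_def)
  finally show ?thesis by (simp add: sum_list_sum_nth atLeast0LessThan)
qed

text \<open>The dilation factor is unrestricted, so a single usable ball of positive radius can be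
  blown up to the whole space. If there is none, all balls with a center have radius 0 and cover
  just their centers, and the total budget decides.\<close>

lemma robust_feasible_iff:
  fixes d :: "nat \<Rightarrow> nat \<Rightarrow> real"
  assumes met: "Metric_space {..<n} d" and len: "length r = length k"
    and r: "\<And>x. x \<in> set r \<Longrightarrow> 0 \<le> x" and m: "m \<le> int n"
  shows "(\<exists>C \<beta>. robust_solution {..<n} d r k m C \<beta>) \<longleftrightarrow>
    (\<exists>i<length k. 0 < r ! i \<and> 0 < k ! i) \<or> m \<le> int (sum_list k)"
proof (intro iffI disjCI)
  interpret Metric_space "{..<n}" d by (rule met)
  assume "\<exists>C \<beta>. robust_solution {..<n} d r k m C \<beta>" and no: "\<not> m \<le> int (sum_list k)"
  then obtain C \<beta> where sol: "admissible_centers {..<n} k C" "m \<le> int (card (covered {..<n} d r C \<beta>))"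
    unfolding robust_solution_def by blast
  show "\<exists>i<length k. 0 < r ! i \<and> 0 < k ! i"
  proof (rule ccontr)
    assume neg: "\<not> ?thesis"
    have "card (covered {..<n} d r C \<beta>) \<le> sum_list k"
    proof (rule card_covered_le[OF met finite_lessThan sol(1) len])
      fix i c u assume i: "i < length k" "c \<in> C ! i" "u \<in> {..<n}" "d c u \<le> \<beta> * r ! i"
      then have C: "C ! i \<subseteq> {..<n}" "card (C ! i) \<le> k ! i"
        using sol(1) by (auto simp: admissible_centers_def)
      then have "0 < card (C ! i)" using i(2) finite_subset[OF C(1)] by (auto simp: card_gt_0_iff)
      with C(2) neg i(1) have "\<not> 0 < r ! i" by fastforce
      with r[OF nth_mem, of i] i(1) len have "r ! i = 0" by simp
      with i(4) have "d c u = 0" using nonneg[of c u] by simp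
      with i(2,3) C(1) show "u = c" by auto
    qed
    with sol(2) no show False by linarith
  qed
next
  interpret Metric_space "{..<n}" d by (rule met)
  assume "(\<exists>i<length k. 0 < r ! i \<and> 0 < k ! i) \<or> m \<le> int (sum_list k)"
  then show "\<exists>C \<beta>. robust_solution {..<n} d r k m C \<beta>"
  proof
    assume "\<exists>i<length k. 0 < r ! i \<and> 0 < k ! i"
    then obtain i where i: "i < length k" "0 < r ! i" "0 < k ! i" by blast
    \<comment> \<open>The intersection keeps the center inside the space when there are no
      points.\<close>
    define C where "C = (replicate (length k) {})[i := {..<n} \<inter> {0}]"
    \<comment> \<open>The sum of all distances from the center serves as a common upper bound for
      them.\<close>
    define \<beta> where "\<beta> = (\<Sum>x<n. d 0 x) / r ! i"
    have "d 0 x \<le> \<beta> * r ! i" if "x < n" for x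
      using i(2) that member_le_sum[of x "{..<n}" "d 0"] by (simp add: \<beta>_def)
    then have "{..<n} \<subseteq> covered {..<n} d r C \<beta>"
      using i len by (auto simp: in_covered_iff[OF met] C_def intro!: exI[of _ i])
    moreover have "covered {..<n} d r C \<beta> \<subseteq> {..<n}" by (auto simp: in_covered_iff[OF met])
    ultimately have "card (covered {..<n} d r C \<beta>) = n" by (metis card_lessThan subset_antisym)
    moreover have "card ({..<n} \<inter> {0}) \<le> 1"
      using card_mono[of "{0 :: nat}" "{..<n} \<inter> {0}"] by simp
    then have "admissible_centers {..<n} k C"
      using i by (auto simp: admissible_centers_def C_def nth_list_update)
    moreover have "0 \<le> \<beta>" using i(2) by (auto simp: \<beta>_def intro!: divide_nonneg_pos sum_nonneg)
    ultimately show ?thesis using m unfolding robust_solution_def by (intro exI[of _ C] exI[of _ \<beta>]) simp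
  next
    assume le: "m \<le> int (sum_list k)"
    \<comment> \<open>The partial sums of the budgets cut the first \<open>sum_list k\<close>
      numbers into blocks of lengths \<open>k ! i\<close>; each block provides the centers for one
      radius. At dilation factor 0 every center covers itself.\<close>
    define S where "S i = sum_list (take i k)" for i
    have S: "S (Suc i) = S i + k ! i" if "i < length k" for i
      using that by (simp add: S_def take_Suc_conv_app_nth)
    define C where "C = map (\<lambda>i. {S i..<S (Suc i)} \<inter> {..<n}) [0..<length k]"
    have adm: "admissible_centers {..<n} k C"
    proof -
      have "card ({S i..<S (Suc i)} \<inter> {..<n}) \<le> k ! i" if "i < length k" for i
        using card_mono[of "{S i..<S (Suc i)}" "{S i..<S (Suc i)} \<inter> {..<n}"] S[OF that] by simp
      then show ?thesis by (auto simp: admissible_centers_def C_def)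
    qed
    have "{..<S j} \<subseteq> (\<Union>i<j. {S i..<S (Suc i)})" if "j \<le> length k" for j
      using that
    proof (induction j)
      case 0
      then show ?case by (simp add: S_def)
    next
      case (Suc j)
      then have IH: "{..<S j} \<subseteq> (\<Union>i<j. {S i..<S (Suc i)})" by simp
      have "{..<S (Suc j)} \<subseteq> {..<S j} \<union> {S j..<S (Suc j)}" by auto
      also have "\<dots> \<subseteq> (\<Union>i<Suc j. {S i..<S (Suc i)})" using IH by (simp add: lessThan_Suc) blast
      finally show ?case .
    qed
    from this[of "length k"] have S_cover: "{..<sum_list k} \<subseteq> (\<Union>i<length k. {S i..<S (Suc i)})"
      by (simp add: S_def)
    have "{..<min n (sum_list k)} \<subseteq> covered {..<n} d r C 0"
    proof
      fix x assume x: "x \<in> {..<min n (sum_list k)}"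
      then have xn: "x < n" by simp
      from x S_cover obtain i where i: "i < length k" "x \<in> {S i..<S (Suc i)}" by force
      then have "x \<in> C ! i" using xn by (simp add: C_def)
      moreover have "d x x = 0" using xn by simp
      ultimately show "x \<in> covered {..<n} d r C 0"
        using i(1) xn len unfolding in_covered_iff[OF met]
        by (intro conjI exI[of _ i] bexI[of _ x]) simp_all
    qed
    moreover have "covered {..<n} d r C 0 \<subseteq> {..<n}" by (auto simp: in_covered_iff[OF met])
    ultimately have "min n (sum_list k) \<le> card (covered {..<n} d r C 0)"
      by (metis card_lessThan card_mono finite_lessThan finite_subset)
    with adm show ?thesis using le m unfolding robust_solution_def
      by (intro exI[of _ C] exI[of _ 0]) auto
  qed
qed

section \<open>Unreduced fractions\<close>

definition quot :: "int \<times> int \<Rightarrow> real" where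
  "quot f = real_of_int (fst f) / real_of_int (snd f)"

text \<open>The inequality \<open>q \<le> f * r\<close> with denominators cleared, so that only
  integer products are compared and no fraction has to be brought to lowest terms.\<close>

definition frac_le :: "rat \<Rightarrow> int \<times> int \<Rightarrow> rat \<Rightarrow> bool" where
  "frac_le q f r \<longleftrightarrow> fst (quotient_of q) * (snd f * snd (quotient_of r)) \<le>
     fst f * fst (quotient_of r) * snd (quotient_of q)"

text \<open>A radius that is not positive yields \<open>0/1\<close>, which is a candidate anyway;
  this keeps all denominators positive.\<close>

definition ratio :: "rat \<Rightarrow> rat \<Rightarrow> int \<times> int" where
  "ratio q r = (if 0 < fst (quotient_of r)
     then (fst (quotient_of q) * snd (quotient_of r), snd (quotient_of q) * fst (quotient_of r))
     else (0, 1))"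

lemma of_rat_quotient_of: "real_of_rat q = quot (quotient_of q)"
  using quotient_of_div[of q "fst (quotient_of q)" "snd (quotient_of q)"]
  by (metis of_rat_divide of_rat_of_int_eq prod.collapse quot_def)

lemma snd_quotient_of_pos: "0 < snd (quotient_of q)"
  by (metis prod.collapse quotient_of_denom_pos)

lemma frac_le_iff:
  assumes "0 < snd f"
  shows "frac_le q f r \<longleftrightarrow> real_of_rat q \<le> quot f * real_of_rat r"
proof -
  have "real_of_rat q \<le> quot f * real_of_rat r \<longleftrightarrow>
      real_of_int (fst (quotient_of q) * (snd f * snd (quotient_of r)))
      \<le> real_of_int (fst f * fst (quotient_of r) * snd (quotient_of q))"
    using assms snd_quotient_of_pos[of q] snd_quotient_of_pos[of r]
    unfolding of_rat_quotient_of quot_def by (simp add: divide_simps mult_ac)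
  then show ?thesis unfolding frac_le_def of_int_le_iff by blast
qed

lemma ratio_denom_pos: "0 < snd (ratio q r)"
  using snd_quotient_of_pos[of q] by (simp add: ratio_def)

lemma quot_ratio: "0 < r \<Longrightarrow> quot (ratio q r) = real_of_rat q / real_of_rat r"
proof -
  assume "0 < r"
  then have "0 < real_of_rat r" by simp
  then have "0 < fst (quotient_of r)"
    using snd_quotient_of_pos[of r] by (simp add: of_rat_quotient_of quot_def zero_less_divide_iff)
  then show ?thesis by (simp add: ratio_def of_rat_quotient_of quot_def)
qed

lemma ratio_nonneg: "0 \<le> q \<Longrightarrow> 0 \<le> fst (ratio q r)"
proof -
  assume "0 \<le> q"
  then have "0 \<le> real_of_rat q" by simp
  then have "0 \<le> fst (quotient_of q)"
    using snd_quotient_of_pos[of q] by (simp add: of_rat_quotient_of quot_def zero_le_divide_iff)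
  then show ?thesis using snd_quotient_of_pos[of r] by (simp add: ratio_def)
qed

section \<open>The reduction on concrete inputs\<close>

definition dist_matrix :: "'z nukc_input_scheme \<Rightarrow> rat list list" where
  "dist_matrix I = map (\<lambda>x. map (distance I x) [0..<npoints I]) [0..<npoints I]"

definition candidates :: "nukc_input \<Rightarrow> (int \<times> int) list" where
  "candidates I = (0, 1) # concat (map (\<lambda>q. map (ratio q) (radii I)) (concat (dist_matrix I)))"

definition net :: "nukc_input \<Rightarrow> int \<times> int \<Rightarrow> nat list" where
  "net I \<gamma> = greedy (\<lambda>x y. frac_le (distance I x y) (2 * fst \<gamma>, snd \<gamma>) (last (radii I))) [0..<npoints I]"

definition reduced :: "nukc_input \<Rightarrow> nat list \<Rightarrow> robust_input" where
  "reduced I ps = \<lparr>npoints = length ps, distance = (\<lambda>x y. distance I (ps ! x) (ps ! y)),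
     radii = butlast (radii I), budgets = butlast (budgets I),
     target = int (length ps) - int (last (budgets I))\<rparr>"

text \<open>The computable form of the criterion in \<open>robust_feasible_iff\<close>.\<close>

definition has_solution :: "robust_input \<Rightarrow> bool" where
  "has_solution J \<longleftrightarrow> (\<exists>i\<in>set [0..<length (budgets J)]. 0 < radii J ! i \<and> 0 < budgets J ! i) \<or>
     target J \<le> int (sum_list (budgets J))"

definition missed :: "nukc_input \<Rightarrow> nat list \<Rightarrow> nat list list \<Rightarrow> int \<times> int \<Rightarrow> nat list" where
  "missed I ps C f = filter (\<lambda>p. \<not> (\<exists>i\<in>set [0..<length C]. \<exists>c\<in>set (C ! i).
     frac_le (distance I c p) f (radii I ! i))) ps"

text \<open>The resulting fraction is the sum of \<open>f\<close> and twice \<open>\<gamma>\<close>,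
  over the product of the two denominators.\<close>

definition extend :: "nukc_input \<Rightarrow> int \<times> int \<Rightarrow> nat list \<Rightarrow> nat list list \<Rightarrow> int \<times> int \<Rightarrow>
    nat list list \<times> (int \<times> int)" where
  "extend I \<gamma> ps C f = (C @ [missed I ps C f], (fst f * snd \<gamma> + 2 * fst \<gamma> * snd f, snd f * snd \<gamma>))"

lemma valid_inputD:
  assumes "valid_input t I"
  shows "Metric_space (pts I) (real_dist I)" "length (real_radii I) = t" "length (radii I) = t"
    "length (budgets I) = t" "sorted_wrt (\<ge>) (real_radii I)" "\<And>r. r \<in> set (real_radii I) \<Longrightarrow> 0 \<le> r"
    "\<And>r. r \<in> set (radii I) \<Longrightarrow> 0 \<le> r" "\<And>x y. 0 \<le> distance I x y"
proof -
  interpret Metric_space "pts I" "real_dist I" using assms by (simp add: valid_input_def)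
  show "0 \<le> distance I x y" for x y using nonneg[of x y] by (simp add: real_dist_def)
qed (use assms in \<open>auto simp: valid_input_def real_radii_def sorted_wrt_map of_rat_less_eq\<close>)

lemma reduced_simps:
  "pts (reduced I ps) = {..<length ps}"
  "real_dist (reduced I ps) = (\<lambda>x y. real_dist I (ps ! x) (ps ! y))"
  "real_radii (reduced I ps) = butlast (real_radii I)"
  "budgets (reduced I ps) = butlast (budgets I)"
  "target (reduced I ps) = int (length ps) - int (last (budgets I))"
  by (simp_all add: reduced_def pts_def real_dist_def real_radii_def map_butlast fun_eq_iff)

lemma valid_reduced:
  assumes "valid_input (Suc s) I" "distinct ps" "set ps \<subseteq> pts I"
  shows "valid_input s (reduced I ps)"
proof -
  note v = valid_inputD[OF assms(1)]
  have "sorted_wrt (\<ge>) (radii I)" using assms(1) by (simp add: valid_input_def)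
  then have "sorted_wrt (\<ge>) (butlast (radii I))"
    by (cases "radii I" rule: rev_cases) (auto simp: sorted_wrt_append)
  then show ?thesis
    using Metric_space_nth[OF v(1) assms(2,3)] v(3,4,7)
    by (auto simp: valid_input_def reduced_simps) (auto simp: reduced_def dest: in_set_butlastD)
qed

lemma has_solution_iff:
  assumes "valid_input s J" "target J \<le> int (npoints J)"
  shows "has_solution J \<longleftrightarrow>
    (\<exists>C \<beta>. robust_solution (pts J) (real_dist J) (real_radii J) (budgets J) (target J) C \<beta>)"
proof -
  note v = valid_inputD[OF assms(1)]
  have "0 < real_radii J ! i \<longleftrightarrow> 0 < radii J ! i" if "i < length (budgets J)" for i
    using that v(3,4) by (simp add: real_radii_def)
  then have "has_solution J \<longleftrightarrow> (\<exists>i<length (budgets J). 0 < real_radii J ! i \<and> 0 < budgets J ! i) \<or>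
      target J \<le> int (sum_list (budgets J))"
    unfolding has_solution_def by auto
  then show ?thesis
    using robust_feasible_iff[of "npoints J" "real_dist J" "real_radii J" "budgets J" "target J"]
      v assms(2) by (simp add: pts_def)
qed

lemma net_props:
  assumes I: "valid_input (Suc s) I" and \<gamma>: "0 \<le> fst \<gamma>" "0 < snd \<gamma>"
  shows "distinct (net I \<gamma>)" "set (net I \<gamma>) \<subseteq> pts I"
    "\<And>x y. x \<in> set (net I \<gamma>) \<Longrightarrow> y \<in> set (net I \<gamma>) \<Longrightarrow> x \<noteq> y \<Longrightarrow>
      2 * quot \<gamma> * last (real_radii I) < real_dist I x y"
    "\<And>x. x \<in> pts I \<Longrightarrow> \<exists>y\<in>set (net I \<gamma>). real_dist I x y \<le> 2 * quot \<gamma> * last (real_radii I)"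
proof -
  note v = valid_inputD[OF I]
  interpret Metric_space "pts I" "real_dist I" by (rule v(1))
  let ?R = "\<lambda>x y. frac_le (distance I x y) (2 * fst \<gamma>, snd \<gamma>) (last (radii I))"
  have "radii I \<noteq> []" using v(3) by auto
  then have last: "last (real_radii I) = real_of_rat (last (radii I))" "0 \<le> last (real_radii I)"
    using v(7)[of "last (radii I)"] by (simp_all add: real_radii_def last_map)
  have R: "?R x y \<longleftrightarrow> real_dist I x y \<le> 2 * quot \<gamma> * last (real_radii I)" for x y
    using \<gamma> by (subst frac_le_iff) (simp_all add: last real_dist_def quot_def)
  have q: "0 \<le> quot \<gamma>" using \<gamma> by (simp add: quot_def)
  have refl: "?R x x" if "x \<in> set [0..<npoints I]" for x
    using that q last(2) unfolding R by (simp add: pts_def)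
  have sym: "?R x y \<Longrightarrow> ?R y x" for x y unfolding R by (simp add: commute)
  show "distinct (net I \<gamma>)" unfolding net_def by (rule distinct_greedy) (rule refl)
  show "set (net I \<gamma>) \<subseteq> pts I" unfolding net_def
    using set_greedy[of ?R "[0..<npoints I]"] by (auto simp: pts_def)
  show "2 * quot \<gamma> * last (real_radii I) < real_dist I x y"
    if "x \<in> set (net I \<gamma>)" "y \<in> set (net I \<gamma>)" "x \<noteq> y" for x y
    using greedy_separated[of ?R, OF sym that[unfolded net_def]] unfolding R by simp
  show "\<exists>y\<in>set (net I \<gamma>). real_dist I x y \<le> 2 * quot \<gamma> * last (real_radii I)" if "x \<in> pts I" for x
    using greedy_covers[of "[0..<npoints I]" ?R x, OF refl] that unfolding R net_def by (simp add: pts_def)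
qed

lemma set_candidates:
  "set (candidates I) = insert (0, 1)
    (\<Union>x<npoints I. \<Union>y<npoints I. ratio (distance I x y) ` set (radii I))"
  by (simp add: candidates_def dist_matrix_def atLeast0LessThan)

lemma candidates_nonneg:
  assumes "valid_input t I" "\<gamma> \<in> set (candidates I)"
  shows "0 \<le> fst \<gamma>" "0 < snd \<gamma>"
  using assms(2) ratio_nonneg[OF valid_inputD(8)[OF assms(1)]] ratio_denom_pos
  by (auto simp: set_candidates)

lemma feasible_candidates:
  assumes I: "valid_input t I"
    and sol: "nukc_solution (pts I) (real_dist I) (real_radii I) (budgets I) C \<beta>"
  shows "\<exists>\<gamma>\<in>set (candidates I). quot \<gamma> \<le> \<beta> \<and>
    nukc_solution (pts I) (real_dist I) (real_radii I) (budgets I) C (quot \<gamma>)"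
proof -
  note v = valid_inputD[OF I]
  have "\<exists>q\<in>quot ` set (candidates I). q \<le> \<beta> \<and>
      nukc_solution (pts I) (real_dist I) (real_radii I) (budgets I) C q"
  proof (rule feasible_candidate[OF v(1) v(6) sol])
    show "0 \<in> quot ` set (candidates I)" by (force simp: set_candidates quot_def)
    fix x y i assume *: "x \<in> pts I" "y \<in> pts I" "i < length (real_radii I)" "0 < real_radii I ! i"
    then have i: "i < length (radii I)" "0 < radii I ! i" by (simp_all add: real_radii_def)
    have "ratio (distance I x y) (radii I ! i) \<in> set (candidates I)"
      using *(1,2) i(1) unfolding set_candidates
      by (intro insertI2 UN_I[of x] UN_I[of y] imageI nth_mem) (auto simp: pts_def)
    moreover have "quot (ratio (distance I x y) (radii I ! i)) = real_dist I x y / real_radii I ! i"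
      using i by (simp add: quot_ratio real_dist_def real_radii_def)
    ultimately show "real_dist I x y / real_radii I ! i \<in> quot ` set (candidates I)"
      by (metis imageI)
  qed auto
  then show ?thesis by blast
qed

lemma reduced_feasible:
  assumes I: "valid_input (Suc s) I" and \<gamma>: "0 \<le> fst \<gamma>" "0 < snd \<gamma>"
    and sol: "nukc_solution (pts I) (real_dist I) (real_radii I) (budgets I) C (quot \<gamma>)"
  defines "J \<equiv> reduced I (net I \<gamma>)"
  shows "\<exists>C'. robust_solution (pts J) (real_dist J) (real_radii J) (budgets J) (target J) C' (2 * quot \<gamma>)"
  unfolding J_def reduced_simps
  using valid_inputD[OF I] net_props[OF I \<gamma>]
  by (intro feasible_reduced[OF _ _ _ _ sol, where s = s]) (auto simp: pts_def)

lemma extend_correct: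
  assumes I: "valid_input (Suc s) I" and \<gamma>: "0 \<le> fst \<gamma>" "0 < snd \<gamma>" and f: "0 < snd f"
  defines "J \<equiv> reduced I (net I \<gamma>)"
  assumes sol: "robust_solution (pts J) (real_dist J) (real_radii J) (budgets J) (target J) (map set L) (quot f)"
  defines "out \<equiv> extend I \<gamma> (net I \<gamma>) (map (map ((!) (net I \<gamma>))) L) f"
  shows "nukc_solution (pts I) (real_dist I) (real_radii I) (budgets I) (map set (fst out)) (quot (snd out))"
    "quot (snd out) = quot f + 2 * quot \<gamma>" "0 < snd (snd out)"
proof -
  note v = valid_inputD[OF I]
  let ?ps = "net I \<gamma>"
  have len: "length L = s"
    using sol v by (simp add: robust_solution_def admissible_centers_def J_def reduced_simps)
  show q: "quot (snd out) = quot f + 2 * quot \<gamma>"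
    using f \<gamma>(2) by (simp add: out_def extend_def quot_def field_simps)
  show "0 < snd (snd out)" using f \<gamma> by (simp add: out_def extend_def)
  \<comment> \<open>The rational comparisons are exact, so the filter computes the set
    \<open>M\<close> of \<open>extend_solution\<close>. The index lists in \<open>L\<close> refer to
    positions in the net and are translated into points.\<close>
  have "set (missed I ?ps (map (map ((!) ?ps)) L) f) =
      {p \<in> set ?ps. \<not> (\<exists>i<s. \<exists>c\<in>(!) ?ps ` (map set L ! i). real_dist I c p \<le> quot f * real_radii I ! i)}"
    using len v(3) by (auto simp: missed_def frac_le_iff[OF f] real_dist_def real_radii_def)
  moreover have "map set (map (map ((!) ?ps)) L) = map ((`) ((!) ?ps)) (map set L)" by simp
  ultimately have "map set (fst out) = map ((`) ((!) ?ps)) (map set L) @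
      [{p \<in> set ?ps. \<not> (\<exists>i<s. \<exists>c\<in>(!) ?ps ` (map set L ! i). real_dist I c p \<le> quot f * real_radii I ! i)}]"
    by (simp add: out_def extend_def)
  then show "nukc_solution (pts I) (real_dist I) (real_radii I) (budgets I) (map set (fst out)) (quot (snd out))"
    unfolding q using v net_props[OF I \<gamma>] sol \<gamma> unfolding J_def reduced_simps
    by (simp only:) (intro extend_solution[where s = s and ps = ?ps], auto simp: quot_def)
qed

section \<open>The reduction runs in polynomial time\<close>

definition enc_frac :: "int \<times> int \<Rightarrow> val" where
  "enc_frac f = Pair (Num (fst f)) (Num (snd f))"

lemma enc_list_map: "enc_list ea (map f xs) = enc_list (\<lambda>x. ea (f x)) xs"
  by (induction xs) simp_all

text \<open>\<open>enc_rat\<close> produces only lowest terms, while computed fractions are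
  arbitrary pairs; this equation lets input rationals be handled as such pairs.\<close>

lemma enc_rat_frac: "enc_rat q = enc_frac (quotient_of q)"
  by (simp add: enc_rat_def enc_frac_def)

lemma polytime_frac:
  "polytime S e (\<lambda>I. Num (a I)) \<Longrightarrow> polytime S e (\<lambda>I. Num (b I)) \<Longrightarrow> polytime S e (\<lambda>I. enc_frac (a I, b I))"
  by (simp add: enc_frac_def polytime_Pair)

lemma polytime_frac_components:
  assumes "polytime S e (\<lambda>I. enc_frac (f I))"
  shows "polytime S e (\<lambda>I. Num (fst (f I)))" "polytime S e (\<lambda>I. Num (snd (f I)))"
  using polytime_left[OF assms] polytime_right[OF assms] by (simp_all add: enc_frac_def)

lemmas polytime_rat_components = polytime_frac_components[where f = "\<lambda>I. quotient_of (q I)" for q, folded enc_rat_frac]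

lemma polytime_frac_le:
  assumes "polytime S e (\<lambda>I. enc_rat (q I))" "polytime S e (\<lambda>I. enc_frac (f I))"
    "polytime S e (\<lambda>I. enc_rat (r I))"
  shows "polytime S e (\<lambda>I. val_of_bool (frac_le (q I) (f I) (r I)))"
  unfolding frac_le_def
  by (intro polytime_le polytime_mult polytime_rat_components polytime_frac_components assms)

lemma polytime_rat_pos:
  assumes "polytime S e (\<lambda>I. enc_rat (q I))"
  shows "polytime S e (\<lambda>I. val_of_bool (0 < q I))"
proof -
  have "0 < fst (quotient_of r) \<longleftrightarrow> 0 < r" for r
  proof -
    have "0 < fst (quotient_of r) \<longleftrightarrow> 0 < real_of_rat r"
      using snd_quotient_of_pos[of r] by (simp add: of_rat_quotient_of quot_def zero_less_divide_iff)
    then show ?thesis by simp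
  qed
  then show ?thesis
    using polytime_less[OF polytime_Num[of _ _ 0] polytime_rat_components(1)[OF assms]] by simp
qed

lemma polytime_ratio:
  assumes q: "polytime S e (\<lambda>I. enc_rat (q I))" and r: "polytime S e (\<lambda>I. enc_rat (r I))"
  shows "polytime S e (\<lambda>I. enc_frac (ratio (q I) (r I)))"
proof -
  have "polytime S e (\<lambda>I. if 0 < fst (quotient_of (r I))
      then enc_frac (fst (quotient_of (q I)) * snd (quotient_of (r I)), snd (quotient_of (q I)) * fst (quotient_of (r I)))
      else enc_frac (0, 1))"
    by (intro polytime_If polytime_less polytime_Num polytime_frac polytime_mult
        polytime_rat_components q r)
  then show ?thesis by (rule polytime_cong) (simp add: ratio_def)
qed

lemma
  fixes I :: "'i \<Rightarrow> 'z nukc_input_scheme"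
  assumes "polytime S e (\<lambda>z. enc_nukc (I z))"
  shows polytime_matrix: "polytime S e (\<lambda>z. enc_list (enc_list enc_rat) (dist_matrix (I z)))"
    and polytime_radii: "polytime S e (\<lambda>z. enc_list enc_rat (radii (I z)))"
    and polytime_budgets: "polytime S e (\<lambda>z. enc_list enc_nat (budgets (I z)))"
proof -
  note r = polytime_right[OF assms]
  show "polytime S e (\<lambda>z. enc_list (enc_list enc_rat) (dist_matrix (I z)))"
    using polytime_left[OF r] by (simp add: enc_nukc_def dist_matrix_def enc_list_map)
  show "polytime S e (\<lambda>z. enc_list enc_rat (radii (I z)))"
    using polytime_left[OF polytime_right[OF r]] by (simp add: enc_nukc_def)
  show "polytime S e (\<lambda>z. enc_list enc_nat (budgets (I z)))"
    using polytime_right[OF polytime_right[OF r]] by (simp add: enc_nukc_def)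
qed

text \<open>The interval is built along the rows of the distance matrix, because the number of
  points itself is given in binary.\<close>

lemma polytime_points:
  assumes "polytime S e (\<lambda>z. enc_nukc (I z))"
  shows "polytime S e (\<lambda>z. enc_list enc_nat [0..<npoints (I z)])"
  using polytime_upt_length(1)[OF polytime_matrix[OF assms]] by (simp add: dist_matrix_def)

text \<open>The input holds the distance matrix only, so distances can be looked up just for actual
  points; the membership conditions in the following lemmas come from here.\<close>

lemma polytime_distance:
  assumes I: "polytime S e (\<lambda>z. enc_nukc (I z))"
    and x: "polytime S e (\<lambda>z. enc_nat (x z))" and y: "polytime S e (\<lambda>z. enc_nat (y z))"
    and bound: "\<And>z. z \<in> S \<Longrightarrow> x z < npoints (I z)" "\<And>z. z \<in> S \<Longrightarrow> y z < npoints (I z)"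
  shows "polytime S e (\<lambda>z. enc_rat (distance (I z) (x z) (y z)))"
proof -
  have "polytime S e (\<lambda>z. enc_rat (dist_matrix (I z) ! x z ! y z))"
    by (rule polytime_nth[OF polytime_nth[OF polytime_matrix[OF I] x] y])
      (auto simp: dist_matrix_def bound)
  then show ?thesis by (rule polytime_cong) (simp add: dist_matrix_def bound)
qed

lemma polytime_candidates:
  assumes I: "polytime S e (\<lambda>z. enc_nukc (I z))"
  shows "polytime S e (\<lambda>z. enc_list enc_frac (candidates (I z)))"
  unfolding candidates_def
proof (intro polytime_Cons polytime_frac polytime_Num polytime_concat)
  let ?T = "SIGMA z:S. set (concat (dist_matrix (I z)))"
  have "polytime ?T (ext e enc_rat) (\<lambda>w. enc_list enc_frac (map (ratio (snd w)) (radii (I (fst w)))))"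
    by (rule polytime_map[OF polytime_radii[OF polytime_ext[OF I]]])
      (auto intro!: polytime_ratio polytime_snd polytime_ext[OF polytime_snd[of UNIV]])
  then show "polytime S e (\<lambda>z. enc_list (enc_list enc_frac)
      (map (\<lambda>q. map (ratio q) (radii (I z))) (concat (dist_matrix (I z)))))"
    by (rule polytime_map[OF polytime_concat[OF polytime_matrix[OF I]]])
qed

section \<open>Running time of the stages of the reduction\<close>

lemma polytime_net:
  assumes I: "polytime S e (\<lambda>z. enc_nukc (I z))" and \<gamma>: "polytime S e (\<lambda>z. enc_frac (\<gamma> z))"
    and r: "\<And>z. z \<in> S \<Longrightarrow> radii (I z) \<noteq> []"
  shows "polytime S e (\<lambda>z. enc_list enc_nat (net (I z) (\<gamma> z)))"
proof -
  let ?R = "\<lambda>z x y. frac_le (distance (I z) x y) (2 * fst (\<gamma> z), snd (\<gamma> z)) (last (radii (I z)))"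
  \<comment> \<open>The invariant that the accumulator consists of points makes the distance lookups
    legitimate.\<close>
  let ?T = "{((z, x), ys). z \<in> S \<and> x < npoints (I z) \<and> set ys \<subseteq> {..<npoints (I z)}}"
  let ?U = "SIGMA w:?T. set (snd w)"
  let ?e = "ext (ext e enc_nat) (enc_list enc_nat)"
  note pts = polytime_points[OF I]
  have lift: "polytime ?U (ext ?e enc_nat) (\<lambda>w. f (fst (fst (fst w))))" if "polytime S e f" for f
  proof -
    have "polytime (SIGMA z:S. UNIV) (ext e enc_nat) (\<lambda>w. f (fst w))"
      by (rule polytime_ext[OF that]) auto
    then have "polytime ((SIGMA z:S. UNIV) \<times> UNIV) ?e (\<lambda>w. f (fst (fst w)))"
      by (rule polytime_ext) auto
    then show ?thesis by (rule polytime_ext) auto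
  qed
  have x: "polytime ?U (ext ?e enc_nat) (\<lambda>w. enc_nat (snd (fst (fst w))))"
    by (rule polytime_ext[OF polytime_ext[OF polytime_snd[of UNIV], of UNIV]]) auto
  have "polytime ?U (ext ?e enc_nat) (\<lambda>w. val_of_bool (?R (fst (fst (fst w))) (snd (fst (fst w))) (snd w)))"
    by (intro polytime_frac_le polytime_distance lift[OF I] x polytime_snd polytime_frac
        polytime_mult polytime_Num lift[OF polytime_frac_components(1)[OF \<gamma>]]
        lift[OF polytime_frac_components(2)[OF \<gamma>]] lift[OF polytime_last[OF polytime_radii[OF I] r]])
      auto
  then have "polytime ?T ?e
      (\<lambda>w. val_of_bool (\<exists>y\<in>set (snd w). ?R (fst (fst w)) (snd (fst w)) y))"
    by (rule polytime_Bex[OF polytime_snd])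
  then have "polytime ?T ?e (\<lambda>w. if \<exists>y\<in>set (snd w). ?R (fst (fst w)) (snd (fst w)) y
      then enc_list enc_nat (snd w) else enc_list enc_nat (snd (fst w) # snd w))"
    by (intro polytime_If polytime_snd polytime_Cons polytime_ext[OF polytime_snd[of UNIV]]) auto
  then have step: "polytime ?T ?e (\<lambda>w. enc_list enc_nat (if \<exists>y\<in>set (snd w). ?R (fst (fst w)) (snd (fst w)) y
      then snd w else snd (fst w) # snd w))"
    by (rule polytime_cong) simp
  show ?thesis unfolding net_def greedy_def
  proof (rule polytime_fold[where eb = "enc_list enc_nat" and init = "\<lambda>_. []", OF pts polytime_Nil step])
    show "poly_bounded S (\<lambda>z. val_size (e z)) (\<lambda>z. 1 + val_size (enc_list enc_nat [0..<npoints (I z)]))"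
      by (intro poly_bounded_intros polytime_size[OF pts])
    fix z j assume "z \<in> S" "j < length [0..<npoints (I z)]"
    then show "((z, [0..<npoints (I z)] ! j), fold (\<lambda>x ys. if \<exists>y\<in>set ys. ?R z x y then ys else x # ys)
        (take j [0..<npoints (I z)]) []) \<in> ?T"
      using set_greedy[of "?R z" "take j [0..<npoints (I z)]"] unfolding greedy_def by fastforce
  next
    fix z x and ys :: "nat list" assume "((z, x), ys) \<in> ?T"
    then have "val_size (enc_nat x) \<le> val_size (enc_list enc_nat [0..<npoints (I z)])"
      by (intro elem_val_size) auto
    then show "val_size (enc_list enc_nat (if \<exists>y\<in>set ys. ?R z x y then ys else x # ys))
        \<le> val_size (enc_list enc_nat ys) + (1 + val_size (enc_list enc_nat [0..<npoints (I z)]))"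
      by simp
  qed
qed

lemma polytime_reduced:
  assumes I: "polytime S e (\<lambda>z. enc_nukc (I z))" and ps: "polytime S e (\<lambda>z. enc_list enc_nat (ps z))"
    and bound: "\<And>z. z \<in> S \<Longrightarrow> set (ps z) \<subseteq> {..<npoints (I z)}"
    and k: "\<And>z. z \<in> S \<Longrightarrow> budgets (I z) \<noteq> []"
  shows "polytime S e (\<lambda>z. enc_robust (reduced (I z) (ps z)))"
proof -
  let ?T = "SIGMA z:S. set (ps z)"
  let ?U = "SIGMA w:?T. set (ps (fst w))"
  have I1: "polytime ?T (ext e enc_nat) (\<lambda>w. enc_nukc (I (fst w)))"
    by (rule polytime_ext[OF I]) auto
  have "polytime ?U (ext (ext e enc_nat) enc_nat)
      (\<lambda>w. enc_rat (distance (I (fst (fst w))) (snd (fst w)) (snd w)))"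
    by (rule polytime_distance[OF polytime_ext[OF I1] polytime_ext[OF polytime_snd[of UNIV]] polytime_snd])
      (use bound in fastforce)+
  then have "polytime ?T (ext e enc_nat)
      (\<lambda>w. enc_list enc_rat (map (distance (I (fst w)) (snd w)) (ps (fst w))))"
    by (intro polytime_map[OF polytime_ext[OF ps]]) auto
  then have "polytime S e (\<lambda>z. enc_list (enc_list enc_rat) (map (\<lambda>p. map (distance (I z) p) (ps z)) (ps z)))"
    by (rule polytime_map[OF ps])
  \<comment> \<open>The submatrix is computed by running through the chosen points, whereas the code
    of the reduced input describes it by indices.\<close>
  moreover have "enc_list (enc_list enc_rat) (map (\<lambda>p. map (distance J p) qs) qs) =
      enc_list (\<lambda>x. enc_list (\<lambda>y. enc_rat (distance J (qs ! x) (qs ! y))) [0..<length qs]) [0..<length qs]"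
    for J :: nukc_input and qs
  proof -
    have "map (\<lambda>p. map (distance J p) qs) qs =
        map (\<lambda>x. map (\<lambda>y. distance J (qs ! x) (qs ! y)) [0..<length qs]) [0..<length qs]"
      by (rule nth_equalityI) (auto intro: nth_equalityI)
    then show ?thesis by (simp add: enc_list_map)
  qed
  ultimately have matrix: "polytime S e (\<lambda>z. enc_list (\<lambda>x. enc_list (\<lambda>y.
      enc_rat (distance (I z) (ps z ! x) (ps z ! y))) [0..<length (ps z)]) [0..<length (ps z)])"
    by simp
  show ?thesis
    unfolding enc_robust_def enc_nukc_def reduced_def
    using matrix polytime_upt_length(2)[OF ps] polytime_last[OF polytime_budgets[OF I] k]
    by (auto intro!: polytime_Pair polytime_diff polytime_butlast polytime_radii[OF I] polytime_budgets[OF I]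
        simp: enc_nat_def)
qed

lemma polytime_has_solution:
  assumes J: "polytime S e (\<lambda>z. enc_robust (J z))"
    and len: "\<And>z. z \<in> S \<Longrightarrow> length (radii (J z)) = length (budgets (J z))"
  shows "polytime S e (\<lambda>z. val_of_bool (has_solution (J z)))"
proof -
  have I: "polytime S e (\<lambda>z. enc_nukc (J z))" and m: "polytime S e (\<lambda>z. Num (target (J z)))"
    using polytime_right[OF J] polytime_left[OF J] by (simp_all add: enc_robust_def)
  let ?T = "SIGMA z:S. set [0..<length (budgets (J z))]"
  have I1: "polytime ?T (ext e enc_nat) (\<lambda>w. enc_nukc (J (fst w)))"
    by (rule polytime_ext[OF I]) auto
  have "polytime ?T (ext e enc_nat) (\<lambda>w. enc_nat (budgets (J (fst w)) ! snd w))"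
    by (rule polytime_nth[OF polytime_budgets[OF I1] polytime_snd]) auto
  then have k: "polytime ?T (ext e enc_nat) (\<lambda>w. Num (int (budgets (J (fst w)) ! snd w)))"
    by (rule polytime_cong) (simp add: enc_nat_def)
  have r: "polytime ?T (ext e enc_nat) (\<lambda>w. enc_rat (radii (J (fst w)) ! snd w))"
    by (rule polytime_nth[OF polytime_radii[OF I1] polytime_snd]) (auto simp: len)
  have "polytime ?T (ext e enc_nat)
      (\<lambda>w. val_of_bool (0 < radii (J (fst w)) ! snd w \<and> 0 < budgets (J (fst w)) ! snd w))"
    using polytime_conj[OF polytime_rat_pos[OF r] polytime_less[OF polytime_Num[of _ _ 0] k]]
    by simp
  from polytime_Bex[OF polytime_upt_length(1)[OF polytime_budgets[OF I]] this]
  have ex: "polytime S e (\<lambda>z. val_of_bool (\<exists>i\<in>set [0..<length (budgets (J z))].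
      0 < radii (J z) ! i \<and> 0 < budgets (J z) ! i))" .
  show ?thesis unfolding has_solution_def
    using polytime_sum_list[OF polytime_budgets[OF I]]
    by (intro polytime_disj ex polytime_le m) (simp add: enc_nat_def)
qed

text \<open>Translates the centers returned for the reduced instance, which are positions in
  \<open>ps\<close>, into points of the original space.\<close>

lemma polytime_map_nth:
  assumes ps: "polytime S e (\<lambda>z. enc_list enc_nat (ps z))"
    and L: "polytime S e (\<lambda>z. enc_list (enc_list enc_nat) (L z))"
    and bound: "\<And>z l. z \<in> S \<Longrightarrow> l \<in> set (L z) \<Longrightarrow> set l \<subseteq> {..<length (ps z)}"
  shows "polytime S e (\<lambda>z. enc_list (enc_list enc_nat) (map (map ((!) (ps z))) (L z)))"
proof (rule polytime_map[OF L])
  let ?T = "SIGMA z:S. set (L z)"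
  have ps1: "polytime ?T (ext e (enc_list enc_nat)) (\<lambda>w. enc_list enc_nat (ps (fst w)))"
    by (rule polytime_ext[OF ps]) auto
  show "polytime ?T (ext e (enc_list enc_nat)) (\<lambda>w. enc_list enc_nat (map ((!) (ps (fst w))) (snd w)))"
  proof (rule polytime_map[OF polytime_snd])
    show "polytime (SIGMA w:?T. set (snd w)) (ext (ext e (enc_list enc_nat)) enc_nat)
        (\<lambda>v. enc_nat (ps (fst (fst v)) ! snd v))"
      by (rule polytime_nth[OF polytime_ext[OF ps1] polytime_snd]) (use bound in fastforce)+
  qed
qed

lemma polytime_missed:
  assumes I: "polytime S e (\<lambda>z. enc_nukc (I z))" and ps: "polytime S e (\<lambda>z. enc_list enc_nat (ps z))"
    and C: "polytime S e (\<lambda>z. enc_list (enc_list enc_nat) (C z))"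
    and f: "polytime S e (\<lambda>z. enc_frac (f z))"
    and bound: "\<And>z. z \<in> S \<Longrightarrow> set (ps z) \<subseteq> {..<npoints (I z)}"
      "\<And>z l. z \<in> S \<Longrightarrow> l \<in> set (C z) \<Longrightarrow> set l \<subseteq> {..<npoints (I z)}"
      "\<And>z. z \<in> S \<Longrightarrow> length (C z) \<le> length (radii (I z))"
  shows "polytime S e (\<lambda>z. enc_list enc_nat (missed (I z) (ps z) (C z) (f z)))"
proof -
  \<comment> \<open>The contexts of three nested loops: over net points, over the radii, and over
    the centers belonging to a radius.\<close>
  let ?T = "SIGMA z:S. set (ps z)"
  let ?U = "SIGMA w:?T. set [0..<length (C (fst w))]"
  let ?W = "SIGMA v:?U. set (C (fst (fst v)) ! snd v)"
  let ?e = "ext (ext e enc_nat) enc_nat"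
  have lift1: "polytime ?T (ext e enc_nat) (\<lambda>w. g (fst w))" if "polytime S e g" for g
    by (rule polytime_ext[OF that]) auto
  have lift2: "polytime ?U ?e (\<lambda>w. g (fst (fst w)))" if "polytime S e g" for g
    by (rule polytime_ext[OF lift1[OF that]]) auto
  have lift3: "polytime ?W (ext ?e enc_nat) (\<lambda>w. g (fst (fst (fst w))))" if "polytime S e g" for g
    by (rule polytime_ext[OF lift2[OF that]]) auto
  have p: "polytime ?W (ext ?e enc_nat) (\<lambda>w. enc_nat (snd (fst (fst w))))"
    by (rule polytime_ext[OF polytime_ext[OF polytime_snd[of UNIV], of UNIV]]) auto
  have i: "polytime ?W (ext ?e enc_nat) (\<lambda>w. enc_nat (snd (fst w)))"
    by (rule polytime_ext[OF polytime_snd[of UNIV]]) auto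
  have "polytime ?W (ext ?e enc_nat) (\<lambda>w. val_of_bool (frac_le
      (distance (I (fst (fst (fst w)))) (snd w) (snd (fst (fst w)))) (f (fst (fst (fst w))))
      (radii (I (fst (fst (fst w)))) ! snd (fst w))))"
  proof (intro polytime_frac_le lift3[OF f])
    show "polytime ?W (ext ?e enc_nat) (\<lambda>w. enc_rat (radii (I (fst (fst (fst w)))) ! snd (fst w)))"
      by (rule polytime_nth[OF polytime_radii[OF lift3[OF I]] i]) (use bound(3) in fastforce)
    show "polytime ?W (ext ?e enc_nat)
        (\<lambda>w. enc_rat (distance (I (fst (fst (fst w)))) (snd w) (snd (fst (fst w)))))"
    proof (rule polytime_distance[OF lift3[OF I] polytime_snd p])
      fix w assume "w \<in> ?W"
      then obtain z p i c where w: "w = (((z, p), i), c)" "z \<in> S" "p \<in> set (ps z)"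
        "i < length (C z)" "c \<in> set (C z ! i)" by auto
      then show "snd w < npoints (I (fst (fst (fst w))))"
        using bound(2)[OF w(2) nth_mem[OF w(4)]] by auto
      show "snd (fst (fst w)) < npoints (I (fst (fst (fst w))))"
        using w bound(1)[OF w(2)] by auto
    qed
  qed
  then have "polytime ?U ?e (\<lambda>w. val_of_bool (\<exists>c\<in>set (C (fst (fst w)) ! snd w).
      frac_le (distance (I (fst (fst w))) c (snd (fst w))) (f (fst (fst w))) (radii (I (fst (fst w))) ! snd w)))"
    by (intro polytime_Bex[OF polytime_nth[OF lift2[OF C] polytime_snd]]) auto
  then have "polytime ?T (ext e enc_nat) (\<lambda>w. val_of_bool (\<exists>i\<in>set [0..<length (C (fst w))].
      \<exists>c\<in>set (C (fst w) ! i). frac_le (distance (I (fst w)) c (snd w)) (f (fst w)) (radii (I (fst w)) ! i)))"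
    by (rule polytime_Bex[OF polytime_upt_length(1)[OF lift1[OF C]]])
  from polytime_filter[OF ps polytime_not[OF this]] show ?thesis
    unfolding missed_def .
qed

section \<open>Assembling and comparing outputs\<close>

definition enc_out :: "nat list list \<times> (int \<times> int) \<Rightarrow> val" where
  "enc_out x = Pair (enc_list (enc_list enc_nat) (fst x)) (enc_frac (snd x))"

lemma polytime_extend:
  assumes I: "polytime S e (\<lambda>z. enc_nukc (I z))" and \<gamma>: "polytime S e (\<lambda>z. enc_frac (\<gamma> z))"
    and ps: "polytime S e (\<lambda>z. enc_list enc_nat (ps z))"
    and C: "polytime S e (\<lambda>z. enc_list (enc_list enc_nat) (C z))"
    and f: "polytime S e (\<lambda>z. enc_frac (f z))"
    and bound: "\<And>z. z \<in> S \<Longrightarrow> set (ps z) \<subseteq> {..<npoints (I z)}"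
      "\<And>z l. z \<in> S \<Longrightarrow> l \<in> set (C z) \<Longrightarrow> set l \<subseteq> {..<npoints (I z)}"
      "\<And>z. z \<in> S \<Longrightarrow> length (C z) \<le> length (radii (I z))"
  shows "polytime S e (\<lambda>z. enc_out (extend (I z) (\<gamma> z) (ps z) (C z) (f z)))"
  unfolding enc_out_def extend_def fst_conv snd_conv
  by (intro polytime_Pair polytime_append[OF C] polytime_Cons polytime_missed[OF I ps C f] polytime_Nil
      bound polytime_frac polytime_add polytime_mult polytime_frac_components[OF \<gamma>]
      polytime_frac_components[OF f] polytime_Num)

text \<open>The initial value \<open>1/0\<close> behaves as infinity in the cross-multiplied comparison.\<close>

definition best :: "(nat list list \<times> (int \<times> int)) list \<Rightarrow> nat list list \<times> (int \<times> int)" where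
  "best xs = fold (\<lambda>x b. if fst (snd x) * snd (snd b) < fst (snd b) * snd (snd x) then x else b)
     xs ([], (1, 0))"

lemma best_snoc:
  "best (xs @ [x]) = (if fst (snd x) * snd (snd (best xs)) < fst (snd (best xs)) * snd (snd x)
     then x else best xs)"
  by (simp add: best_def)

lemma best_correct:
  assumes "\<And>x. x \<in> set xs \<Longrightarrow> 0 < snd (snd x)" "xs \<noteq> []"
  shows "best xs \<in> set xs \<and> (\<forall>x\<in>set xs. quot (snd (best xs)) \<le> quot (snd x))"
  using assms
proof (induction xs rule: rev_induct)
  case (snoc x xs)
  show ?case
  proof (cases "xs = []")
    case True
    with snoc.prems(1)[of x] show ?thesis by (simp add: best_snoc) (simp add: best_def)
  next
    case False
    with snoc have IH: "best xs \<in> set xs" "\<And>y. y \<in> set xs \<Longrightarrow> quot (snd (best xs)) \<le> quot (snd y)"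
      by auto
    have pos: "0 < snd (snd x)" "0 < snd (snd (best xs))" using snoc.prems(1) IH(1) by auto
    have "fst (snd x) * snd (snd (best xs)) < fst (snd (best xs)) * snd (snd x) \<longleftrightarrow>
        real_of_int (fst (snd x) * snd (snd (best xs))) < real_of_int (fst (snd (best xs)) * snd (snd x))"
      by (simp only: of_int_less_iff)
    also have "\<dots> \<longleftrightarrow> quot (snd x) < quot (snd (best xs))"
      using pos by (simp add: quot_def divide_simps)
    finally have "best (xs @ [x]) = (if quot (snd x) < quot (snd (best xs)) then x else best xs)"
      by (simp add: best_snoc)
    then show ?thesis using IH by fastforce
  qed
qed simp

text \<open>The accumulator is always the start value or one of the given outputs. The products
  occur only in the comparison and are not stored.\<close>

lemma polytime_best:
  assumes xs: "polytime S e (\<lambda>z. enc_list enc_out (xs z))"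
  shows "polytime S e (\<lambda>z. enc_out (best (xs z)))"
  unfolding best_def
proof (rule polytime_fold[where eb = enc_out and init = "\<lambda>_. ([], (1, 0))"
      and g = "\<lambda>_ x b. if fst (snd x) * snd (snd b) < fst (snd b) * snd (snd x) then x else b",
      OF xs polytime_const])
  let ?T = "{((z, x), b). x \<in> set (xs z)}"
  let ?e = "ext (ext e enc_out) enc_out"
  have x: "polytime ?T ?e (\<lambda>w. enc_out (snd (fst w)))"
    by (rule polytime_ext[OF polytime_snd[of UNIV]]) auto
  have b: "polytime ?T ?e (\<lambda>w. enc_out (snd w))" by (rule polytime_snd)
  have frac: "polytime ?T ?e (\<lambda>w. enc_frac (snd (g w)))" if "polytime ?T ?e (\<lambda>w. enc_out (g w))" for g
    using polytime_right[OF that] by (simp add: enc_out_def)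
  have "polytime ?T ?e (\<lambda>w. if fst (snd (snd (fst w))) * snd (snd (snd w)) < fst (snd (snd w)) * snd (snd (snd (fst w)))
      then enc_out (snd (fst w)) else enc_out (snd w))"
    by (intro polytime_If polytime_less polytime_mult polytime_frac_components frac x b)
  then show "polytime ?T ?e (\<lambda>w. enc_out (if fst (snd (snd (fst w))) * snd (snd (snd w)) <
      fst (snd (snd w)) * snd (snd (snd (fst w))) then snd (fst w) else snd w))"
    by (rule polytime_cong) simp
  show "poly_bounded S (\<lambda>z. val_size (e z)) (\<lambda>z. val_size (enc_list enc_out (xs z)))"
    by (rule polytime_size[OF xs])
  show "val_size (enc_out (if fst (snd x) * snd (snd b) < fst (snd b) * snd (snd x) then x else b))
      \<le> val_size (enc_out b) + val_size (enc_list enc_out (xs z))" if "((z, x), b) \<in> ?T" for z x b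
    using that elem_val_size[of x "xs z" enc_out] by auto
qed auto

section \<open>The robust algorithm as a function\<close>

lemma solvable_in_polytimeE:
  assumes "solvable_in_polytime S e R"
  obtains f where "polytime S e f" "\<And>I. I \<in> S \<Longrightarrow> R I (f I)"
proof -
  from assms obtain P p where
    P: "\<forall>I\<in>S. \<exists>v n s. exec P (init_store (e I)) n s \<and> n \<le> poly p (val_size (e I)) \<and> R I v \<and> s 0 = v"
    unfolding solvable_in_polytime_def by blast
  \<comment> \<open>Choice fixes an output of the program for every input; the relational guarantee
    becomes a function that can be composed like any other.\<close>
  from bchoice[OF P] obtain f where
    "\<forall>I\<in>S. \<exists>n s. exec P (init_store (e I)) n s \<and> n \<le> poly p (val_size (e I)) \<and> R I (f I) \<and> s 0 = f I"
    by blast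
  then have "polytime S e f" "\<And>I. I \<in> S \<Longrightarrow> R I (f I)"
    unfolding polytime_def solvable_in_polytime_def by blast+
  then show thesis by (rule that)
qed

lemma solvable_in_polytimeI:
  "polytime S e f \<Longrightarrow> (\<And>I. I \<in> S \<Longrightarrow> R I (f I)) \<Longrightarrow> solvable_in_polytime S e R"
  unfolding polytime_def solvable_in_polytime_def by metis

text \<open>Two points at distance 1, one center with radius 1 and both points to be covered: every
  solution has dilation factor at least 1. Since \<open>0 < s\<close> there is a place for this
  center, all other budgets being 0.\<close>

lemma approximation_factor_nonneg:
  assumes "robust_polytime_approximable s \<alpha>" "0 < s"
  shows "0 \<le> \<alpha>"
proof -
  define J :: robust_input where "J = \<lparr>npoints = 2, distance = (\<lambda>x y. if x = y then 0 else 1),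
    radii = replicate s 1, budgets = 1 # replicate (s - 1) 0, target = 2\<rparr>"
  have J: "pts J = {..<2}" "real_dist J = (\<lambda>x y. if x = y then 0 else 1)"
    "real_radii J = replicate s 1" "budgets J = 1 # replicate (s - 1) 0" "target J = 2" "npoints J = 2"
    "radii J = replicate s 1"
    by (auto simp: J_def pts_def real_dist_def real_radii_def fun_eq_iff)
  have met: "Metric_space (pts J) (real_dist J)"
    unfolding J by unfold_locales auto
  then have valid: "valid_input s J"
    using \<open>0 < s\<close> unfolding valid_input_def by (auto simp: J(4,7) sorted_wrt_iff_nth_less)
  have "has_solution J"
    using \<open>0 < s\<close> unfolding has_solution_def by (auto simp: J intro!: bexI[of _ 0])
  then obtain C \<beta>' where feasible:
    "robust_solution (pts J) (real_dist J) (real_radii J) (budgets J) (target J) C \<beta>'"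
    using has_solution_iff[OF valid] by (auto simp: J(5,6))
  have ge1: "1 \<le> \<beta>"
    if sol: "robust_solution (pts J) (real_dist J) (real_radii J) (budgets J) (target J) C \<beta>" for C \<beta>
  proof (rule ccontr)
    assume "\<not> 1 \<le> \<beta>"
    \<comment> \<open>Below dilation factor 1 each ball is just its center, so one center misses the
      target 2.\<close>
    have "card (covered (pts J) (real_dist J) (real_radii J) C \<beta>) \<le> sum_list (budgets J)"
    proof (rule card_covered_le[OF met])
      show "admissible_centers (pts J) (budgets J) C" using sol by (simp add: robust_solution_def)
      fix i c u assume "i < length (budgets J)" "real_dist J c u \<le> \<beta> * real_radii J ! i"
      with \<open>\<not> 1 \<le> \<beta>\<close> \<open>0 < s\<close> show "u = c" by (auto simp: J(2,3,4) split: if_splits)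
    qed (use \<open>0 < s\<close> in \<open>auto simp: J(1,3,4)\<close>)
    then show False using sol by (simp add: robust_solution_def J(4,5) sum_list_replicate)
  qed
  from assms(1) obtain out where "robust_approx_output \<alpha> J (out J)"
    unfolding robust_polytime_approximable_def using valid by (auto elim!: solvable_in_polytimeE)
  with feasible obtain C \<beta> where
    "robust_solution (pts J) (real_dist J) (real_radii J) (budgets J) (target J) C \<beta>"
    "\<beta> \<le> \<alpha> * robust_opt (pts J) (real_dist J) (real_radii J) (budgets J) (target J)"
    unfolding robust_approx_output_def by blast
  moreover from this(1) feasible ge1
  have "1 \<le> robust_opt (pts J) (real_dist J) (real_radii J) (budgets J) (target J)"
    unfolding robust_opt_def by (intro cInf_greatest) auto
  \<comment> \<open>A negative factor times an optimum of at least 1 would be negative, and could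
    not bound a dilation factor that is at least 1.\<close>
  ultimately show ?thesis
    using ge1 by (smt (verit) mult_neg_pos)
qed

text \<open>Center lists and a fraction can be extracted only where the output is guaranteed to be
  well formed, that is on solvable instances. There they are the two components of the output's
  code, hence computable in polynomial time.\<close>

lemma robust_oracle:
  assumes "robust_polytime_approximable s \<alpha>"
  defines "V \<equiv> {J. valid_input s J \<and> target J \<le> int (npoints J) \<and> has_solution J}"
  obtains L f where
    "polytime V enc_robust (\<lambda>J. enc_list (enc_list enc_nat) (L J))"
    "polytime V enc_robust (\<lambda>J. enc_frac (f J))"
    "\<forall>J\<in>V. 0 < snd (f J)"
    "\<forall>J\<in>V. robust_solution (pts J) (real_dist J) (real_radii J) (budgets J) (target J)
      (map set (L J)) (quot (f J))"
    "\<forall>J\<in>V. quot (f J) \<le>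
      \<alpha> * robust_opt (pts J) (real_dist J) (real_radii J) (budgets J) (target J)"
proof -
  from assms(1) obtain out where out: "polytime {J. valid_input s J} enc_robust out"
    "\<And>J. valid_input s J \<Longrightarrow> robust_approx_output \<alpha> J (out J)"
    unfolding robust_polytime_approximable_def by (auto elim!: solvable_in_polytimeE)
  have "\<exists>x. out J = Pair (enc_list (enc_list enc_nat) (fst x)) (enc_frac (snd x)) \<and> 0 < snd (snd x) \<and>
      robust_solution (pts J) (real_dist J) (real_radii J) (budgets J) (target J) (map set (fst x)) (quot (snd x)) \<and>
      quot (snd x) \<le> \<alpha> * robust_opt (pts J) (real_dist J) (real_radii J) (budgets J) (target J)"
    if "J \<in> V" for J
  proof -
    from that have "valid_input s J"
      "\<exists>C \<beta>. robust_solution (pts J) (real_dist J) (real_radii J) (budgets J) (target J) C \<beta>"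
      using has_solution_iff[of s J] by (auto simp: V_def)
    with out(2)[of J] obtain L a b where
      "out J = Pair (enc_list (enc_list enc_nat) L) (Pair (Num a) (Num b))" "b > 0"
      "robust_solution (pts J) (real_dist J) (real_radii J) (budgets J) (target J) (map set L)
        (real_of_int a / real_of_int b)"
      "real_of_int a / real_of_int b \<le>
        \<alpha> * robust_opt (pts J) (real_dist J) (real_radii J) (budgets J) (target J)"
      unfolding robust_approx_output_def output_represents_def by blast
    then show ?thesis by (intro exI[of _ "(L, (a, b))"]) (simp add: enc_frac_def quot_def)
  qed
  then obtain x where x: "\<And>J. J \<in> V \<Longrightarrow>
      out J = Pair (enc_list (enc_list enc_nat) (fst (x J))) (enc_frac (snd (x J))) \<and> 0 < snd (snd (x J)) \<and>
      robust_solution (pts J) (real_dist J) (real_radii J) (budgets J) (target J) (map set (fst (x J))) (quot (snd (x J))) \<and>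
      quot (snd (x J)) \<le> \<alpha> * robust_opt (pts J) (real_dist J) (real_radii J) (budgets J) (target J)"
    by metis
  have "polytime V enc_robust out"
    by (rule polytime_subset[OF out(1)]) (auto simp: V_def)
  show thesis
  proof (rule that[of "\<lambda>J. fst (x J)" "\<lambda>J. snd (x J)"])
    show "polytime V enc_robust (\<lambda>J. enc_list (enc_list enc_nat) (fst (x J)))"
      by (rule polytime_cong[OF polytime_left[OF \<open>polytime V enc_robust out\<close>]]) (simp add: x)
    show "polytime V enc_robust (\<lambda>J. enc_frac (snd (x J)))"
      by (rule polytime_cong[OF polytime_right[OF \<open>polytime V enc_robust out\<close>]]) (simp add: x)
  qed (simp_all add: x)
qed

theorem theorem1:
  fixes t :: nat and \<alpha> :: real
  assumes "t \<ge> 2"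
    and "robust_polytime_approximable (t - 1) \<alpha>"
  shows "nukc_polytime_approximable t (2 * \<alpha> + 2)"
proof -
  obtain s where s: "t = Suc s" "0 < s" using assms(1) by (cases t) auto
  have \<alpha>: "0 \<le> \<alpha>" using approximation_factor_nonneg[of s \<alpha>] assms(2) s by simp
  define V where "V = {J. valid_input s J \<and> target J \<le> int (npoints J) \<and> has_solution J}"
  have robust: "robust_polytime_approximable s \<alpha>" using assms(2) s(1) by simp
  from robust_oracle[OF robust] obtain L f where
    L: "polytime V enc_robust (\<lambda>J. enc_list (enc_list enc_nat) (L J))"
    and f: "polytime V enc_robust (\<lambda>J. enc_frac (f J))" "\<forall>J\<in>V. 0 < snd (f J)"
    and sol: "\<forall>J\<in>V. robust_solution (pts J) (real_dist J) (real_radii J) (budgets J) (target J)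
      (map set (L J)) (quot (f J))"
    and approx: "\<forall>J\<in>V. quot (f J) \<le>
      \<alpha> * robust_opt (pts J) (real_dist J) (real_radii J) (budgets J) (target J)"
    unfolding V_def by blast
  note f_pos = bspec[OF f(2)] and sol = bspec[OF sol] and approx = bspec[OF approx]
  define S where "S = {I :: nukc_input. valid_input t I}"
  define red where "red I \<gamma> = reduced I (net I \<gamma>)" for I \<gamma>
  \<comment> \<open>Each guess kept here leads to a genuine solution of the original instance,
    whether or not the guess itself is feasible.\<close>
  define good where "good I = filter (\<lambda>\<gamma>. has_solution (red I \<gamma>)) (candidates I)" for I
  define centers where "centers I \<gamma> = map (map ((!) (net I \<gamma>))) (L (red I \<gamma>))" for I \<gamma>
  define solve where "solve I \<gamma> = extend I \<gamma> (net I \<gamma>) (centers I \<gamma>) (f (red I \<gamma>))" for I \<gamma>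

  have cand: "valid_input (Suc s) I" "0 \<le> fst \<gamma>" "0 < snd \<gamma>" "valid_input s (red I \<gamma>)"
    "target (red I \<gamma>) \<le> int (npoints (red I \<gamma>))" "set (net I \<gamma>) \<subseteq> {..<npoints I}"
    if "I \<in> S" "\<gamma> \<in> set (candidates I)" for I \<gamma>
  proof -
    show I: "valid_input (Suc s) I" using that s by (simp add: S_def)
    show \<gamma>: "0 \<le> fst \<gamma>" "0 < snd \<gamma>" using candidates_nonneg[OF I that(2)] by auto
    show "valid_input s (red I \<gamma>)" "set (net I \<gamma>) \<subseteq> {..<npoints I}"
      using valid_reduced[OF I] net_props[OF I \<gamma>] by (simp_all add: red_def pts_def)
  qed (simp add: red_def reduced_def)
  have V: "red I \<gamma> \<in> V" if "I \<in> S" "\<gamma> \<in> set (good I)" for I \<gamma>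
    using cand[OF that(1), of \<gamma>] that(2) by (simp add: V_def good_def)
  have correct: "nukc_solution (pts I) (real_dist I) (real_radii I) (budgets I)
      (map set (fst (solve I \<gamma>))) (quot (snd (solve I \<gamma>)))"
    "quot (snd (solve I \<gamma>)) = quot (f (red I \<gamma>)) + 2 * quot \<gamma>" "0 < snd (snd (solve I \<gamma>))"
    if "I \<in> S" "\<gamma> \<in> set (good I)" for I \<gamma>
  proof -
    have "\<gamma> \<in> set (candidates I)" using that(2) by (simp add: good_def)
    note c = cand[OF that(1) this]
    from extend_correct[OF c(1-3) f_pos[OF V[OF that], unfolded red_def] sol[OF V[OF that], unfolded red_def]]
    show "nukc_solution (pts I) (real_dist I) (real_radii I) (budgets I)
        (map set (fst (solve I \<gamma>))) (quot (snd (solve I \<gamma>)))"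
      "quot (snd (solve I \<gamma>)) = quot (f (red I \<gamma>)) + 2 * quot \<gamma>" "0 < snd (snd (solve I \<gamma>))"
      unfolding solve_def centers_def red_def by auto
  qed

  have poly: "polytime S enc_nukc (\<lambda>I. enc_out (best (map (solve I) (good I))))"
  proof -
    \<comment> \<open>The solvability test runs on all candidates, the robust algorithm only on
      those that pass it.\<close>
    let ?T = "SIGMA I:S. set (candidates I)" and ?U = "SIGMA I:S. set (good I)"
    let ?e = "ext enc_nukc enc_frac"
    have I: "polytime ?T ?e (\<lambda>z. enc_nukc (fst z))"
      by (rule polytime_ext[OF polytime_self[of S]]) auto
    have net: "polytime ?T ?e (\<lambda>z. enc_list enc_nat (net (fst z) (snd z)))"
      by (rule polytime_net[OF I polytime_snd]) (auto simp: S_def valid_input_def s(1))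
    have red: "polytime ?T ?e (\<lambda>z. enc_robust (red (fst z) (snd z)))"
      unfolding red_def
    proof (rule polytime_reduced[OF I net])
      fix z assume "z \<in> ?T"
      then have z: "fst z \<in> S" "snd z \<in> set (candidates (fst z))" by auto
      show "set (net (fst z) (snd z)) \<subseteq> {..<npoints (fst z)}" by (rule cand(6)[OF z])
      show "budgets (fst z) \<noteq> []" using cand(1)[OF z] by (auto simp: valid_input_def)
    qed
    have "polytime ?T ?e (\<lambda>z. val_of_bool (has_solution (red (fst z) (snd z))))"
      by (rule polytime_has_solution[OF red]) (use cand(4) in \<open>auto simp: valid_input_def\<close>)
    from polytime_filter[OF polytime_candidates[OF polytime_self] this]
    have good: "polytime S enc_nukc (\<lambda>I. enc_list enc_frac (good I))"
      unfolding good_def .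
    have sub: "?U \<subseteq> ?T" by (auto simp: good_def)
    note I = polytime_subset[OF I sub] and net = polytime_subset[OF net sub]
      and red = polytime_subset[OF red sub]
    have L': "polytime ?U ?e (\<lambda>z. enc_list (enc_list enc_nat) (L (red (fst z) (snd z))))"
      by (rule polytime_lift[OF L red]) (auto intro: V)
    have f': "polytime ?U ?e (\<lambda>z. enc_frac (f (red (fst z) (snd z))))"
      by (rule polytime_lift[OF f(1) red]) (auto intro: V)
    \<comment> \<open>Admissibility of the robust solution ensures that the returned indices are
      positions in the net, as the lookups require.\<close>
    have L_bound: "length (L (red I \<gamma>)) = s \<and> (\<forall>l\<in>set (L (red I \<gamma>)). set l \<subseteq> {..<length (net I \<gamma>)})"
      if "I \<in> S" "\<gamma> \<in> set (good I)" for I \<gamma>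
    proof -
      have "\<gamma> \<in> set (candidates I)" using that(2) by (simp add: good_def)
      with cand(4)[OF that(1)] have k: "length (budgets (red I \<gamma>)) = s" by (simp add: valid_input_def)
      have "admissible_centers (pts (red I \<gamma>)) (budgets (red I \<gamma>)) (map set (L (red I \<gamma>)))"
        using sol[OF V[OF that]] by (simp add: robust_solution_def)
      then have len: "length (L (red I \<gamma>)) = s"
        and "\<forall>i<s. map set (L (red I \<gamma>)) ! i \<subseteq> pts (red I \<gamma>)"
        unfolding admissible_centers_def k by (simp, blast)
      then have "\<forall>i<s. set (L (red I \<gamma>) ! i) \<subseteq> pts (red I \<gamma>)" by simp
      moreover have "pts (red I \<gamma>) = {..<length (net I \<gamma>)}" by (simp add: red_def reduced_simps)
      ultimately show ?thesis using len by (simp add: all_set_conv_all_nth)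
    qed
    have centers: "polytime ?U ?e (\<lambda>z. enc_list (enc_list enc_nat) (centers (fst z) (snd z)))"
      unfolding centers_def by (rule polytime_map_nth[OF net L']) (metis L_bound SigmaE fst_conv snd_conv)
    have "polytime ?U ?e (\<lambda>z. enc_out (solve (fst z) (snd z)))"
      unfolding solve_def
    proof (rule polytime_extend[OF I polytime_snd net centers f'])
      fix z assume "z \<in> ?U"
      then have z: "fst z \<in> S" "snd z \<in> set (good (fst z))" by auto
      then have "snd z \<in> set (candidates (fst z))" by (simp add: good_def)
      note c = cand[OF z(1) this]
      show net: "set (net (fst z) (snd z)) \<subseteq> {..<npoints (fst z)}" by (rule c(6))
      show "length (centers (fst z) (snd z)) \<le> length (radii (fst z))"
        using L_bound[OF z] c(1) by (simp add: centers_def valid_input_def)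
      show "set l \<subseteq> {..<npoints (fst z)}" if "l \<in> set (centers (fst z) (snd z))" for l
        using that L_bound[OF z] net by (fastforce simp: centers_def dest: nth_mem)
    qed
    with good have "polytime S enc_nukc (\<lambda>I. enc_list enc_out (map (solve I) (good I)))"
      by (rule polytime_map)
    then show ?thesis by (rule polytime_best)
  qed

  show ?thesis
    unfolding nukc_polytime_approximable_def
  proof (rule solvable_in_polytimeI[OF poly[unfolded S_def]])
    fix I :: nukc_input assume "I \<in> {I. valid_input t I}"
    then have I: "I \<in> S" "valid_input (Suc s) I" using s by (simp_all add: S_def)
    let ?sol = "nukc_solution (pts I) (real_dist I) (real_radii I) (budgets I)"
    let ?opt = "nukc_opt (pts I) (real_dist I) (real_radii I) (budgets I)"
    define out where "out = best (map (solve I) (good I))"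
    \<comment> \<open>Stated for an arbitrary feasible \<beta>; passing to the infimum at the end
      avoids having to show that the optimum is attained.\<close>
    have key: "\<exists>\<gamma>\<in>set (good I). quot (snd (solve I \<gamma>)) \<le> (2 * \<alpha> + 2) * \<beta>" if "?sol C \<beta>" for C \<beta>
    proof -
      from feasible_candidates[OF I(2) that] obtain \<gamma>
        where \<gamma>: "\<gamma> \<in> set (candidates I)" "quot \<gamma> \<le> \<beta>" "?sol C (quot \<gamma>)" by blast
      note c = cand[OF I(1) \<gamma>(1)]
      let ?J = "red I \<gamma>"
      obtain C' where C': "robust_solution (pts ?J) (real_dist ?J) (real_radii ?J) (budgets ?J) (target ?J)
          C' (2 * quot \<gamma>)"
        using reduced_feasible[OF c(1-3) \<gamma>(3)] unfolding red_def by blast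
      then have good: "\<gamma> \<in> set (good I)"
        using \<gamma>(1) has_solution_iff[OF c(4,5)] by (auto simp: good_def)
      have "robust_opt (pts ?J) (real_dist ?J) (real_radii ?J) (budgets ?J) (target ?J) \<le> 2 * quot \<gamma>"
        unfolding robust_opt_def using C'
        by (intro cInf_lower bdd_belowI[of _ 0]) (auto simp: robust_solution_def)
      then have "quot (f ?J) \<le> \<alpha> * (2 * quot \<gamma>)"
        using approx[OF V[OF I(1) good]] mult_left_mono[OF _ \<alpha>] by (meson order_trans)
      then have "quot (snd (solve I \<gamma>)) \<le> (2 * \<alpha> + 2) * quot \<gamma>"
        using correct(2)[OF I(1) good] by (simp add: algebra_simps)
      also have "\<dots> \<le> (2 * \<alpha> + 2) * \<beta>" using \<gamma>(2) \<alpha> by (intro mult_left_mono) auto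
      finally show ?thesis using good by blast
    qed
    show "nukc_approx_output (2 * \<alpha> + 2) I (enc_out out)"
      unfolding nukc_approx_output_def
    proof (rule impI, elim exE)
      fix C \<beta> assume feasible: "?sol C \<beta>"
      then have ne: "map (solve I) (good I) \<noteq> []" using key by fastforce
      have "0 < snd (snd x)" if "x \<in> set (map (solve I) (good I))" for x
        using that correct(3)[OF I(1)] by (metis imageE set_map)
      from best_correct[OF this ne]
      have out: "out \<in> set (map (solve I) (good I))"
        "\<forall>x\<in>set (map (solve I) (good I)). quot (snd out) \<le> quot (snd x)"
        unfolding out_def by auto
      then obtain \<gamma> where \<gamma>: "\<gamma> \<in> set (good I)" "out = solve I \<gamma>" by auto
      \<comment> \<open>Division by the positive factor turns the estimate into a lower bound on
        every feasible dilation factor, hence on their infimum.\<close>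
      have "quot (snd out) / (2 * \<alpha> + 2) \<le> ?opt"
        unfolding nukc_opt_def
      proof (rule cInf_greatest)
        show "{\<beta>. \<exists>C. ?sol C \<beta>} \<noteq> {}" using feasible by blast
        fix \<beta> assume "\<beta> \<in> {\<beta>. \<exists>C. ?sol C \<beta>}"
        with key obtain \<gamma> where "\<gamma> \<in> set (good I)" "quot (snd (solve I \<gamma>)) \<le> (2 * \<alpha> + 2) * \<beta>"
          by blast
        with out(2) have "quot (snd out) \<le> (2 * \<alpha> + 2) * \<beta>" by force
        then show "quot (snd out) / (2 * \<alpha> + 2) \<le> \<beta>" using \<alpha> by (simp add: divide_simps mult.commute)
      qed
      then have "quot (snd out) \<le> (2 * \<alpha> + 2) * ?opt" using \<alpha> by (simp add: divide_simps mult.commute)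
      moreover have "output_represents (enc_out out) (map set (fst out)) (quot (snd out))"
        using correct(3)[OF I(1) \<gamma>(1)] unfolding output_represents_def \<gamma>(2)[symmetric]
        by (intro exI[of _ "fst out"] exI[of _ "fst (snd out)"] exI[of _ "snd (snd out)"])
          (simp add: enc_out_def enc_frac_def quot_def)
      moreover have "?sol (map set (fst out)) (quot (snd out))"
        using correct(1)[OF I(1) \<gamma>(1)] \<gamma>(2) by simp
      ultimately show "\<exists>C \<beta>. output_represents (enc_out out) C \<beta> \<and> ?sol C \<beta> \<and> \<beta> \<le> (2 * \<alpha> + 2) * ?opt"
        by blast
    qed
  qed
qed

end
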